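(* For any (fixed) integer $\ell\geq 0$, determining whether a given $(1,\ell)$-graph $G$ is well-covered can be done in polynomial time even when no $(1,\ell)$-partition of $G$ is provided.
   Context: Graphs are finite, simple and undirected. For integers $k,\ell\ge 0$, a $(k,\ell)$-graph is a graph whose vertex set can be partitioned into $k$ independent sets and $\ell$ cliques, where parts are allowed to be empty (and a single vertex may be counted either as an independent set or as a clique); such a partition is a $(k,\ell)$-partition. A graph is well-covered if all its maximal (with respect to inclusion) independent sets have the same cardinality. *)

theory Defs
  imports
    "Graph_Theory.Pair_Digraph"
    "HOL-Library.Disjoint_Sets"
    "HOL-Computational_Algebra.Polynomial"
begin

section \<open>Graphs\<close>

text \<open>
  Finite simple undirected graphs are the finite, loop-free, symmetric digraphs without parallel
  arcs, i.e. the instances of \<^locale>\<open>pair_graph\<close>; an edge \<open>uv\<close> is the pair of arcs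
  \<open>(u, v)\<close>, \<open>(v, u)\<close>.
\<close>

definition independent_set :: "'a pair_pre_digraph \<Rightarrow> 'a set \<Rightarrow> bool" where
  "independent_set G I \<longleftrightarrow> I \<subseteq> pverts G \<and> (\<forall>u\<in>I. \<forall>v\<in>I. (u, v) \<notin> parcs G)"

definition clique :: "'a pair_pre_digraph \<Rightarrow> 'a set \<Rightarrow> bool" where
  "clique G C \<longleftrightarrow> C \<subseteq> pverts G \<and> (\<forall>u\<in>C. \<forall>v\<in>C. u \<noteq> v \<longrightarrow> (u, v) \<in> parcs G)"

text \<open>
  The first \<open>k\<close> parts \<open>P 0, \<dots>, P (k - 1)\<close> are the independent sets and the next \<open>l\<close> parts
  are the cliques. \<^const>\<open>disjoint_family_on\<close> allows parts to be empty.
\<close>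

definition kl_partition :: "nat \<Rightarrow> nat \<Rightarrow> 'a pair_pre_digraph \<Rightarrow> (nat \<Rightarrow> 'a set) \<Rightarrow> bool" where
  "kl_partition k l G P \<longleftrightarrow>
     (\<Union>i<k + l. P i) = pverts G \<and> disjoint_family_on P {..<k + l} \<and>
     (\<forall>i<k. independent_set G (P i)) \<and> (\<forall>i\<in>{k..<k + l}. clique G (P i))"

definition kl_graph :: "nat \<Rightarrow> nat \<Rightarrow> 'a pair_pre_digraph \<Rightarrow> bool" where
  "kl_graph k l G \<longleftrightarrow> pair_graph G \<and> (\<exists>P. kl_partition k l G P)"

definition maximal_independent_set :: "'a pair_pre_digraph \<Rightarrow> 'a set \<Rightarrow> bool" where
  "maximal_independent_set G I \<longleftrightarrow>
     independent_set G I \<and> (\<forall>J. independent_set G J \<longrightarrow> I \<subseteq> J \<longrightarrow> J = I)"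

definition well_covered :: "'a pair_pre_digraph \<Rightarrow> bool" where
  "well_covered G \<longleftrightarrow>
     (\<forall>I J. maximal_independent_set G I \<longrightarrow> maximal_independent_set G J \<longrightarrow> card I = card J)"


section \<open>Polynomial time\<close>

text \<open>
  The machine model is the random access machine of Cook and Reckhow (addition, subtraction,
  indirect addressing, conditional jumps) on natural numbers, with the input in separate read-only
  registers. Every instruction costs one time unit. Since there is no multiplication or
  shift, register contents after \<open>t\<close> steps have bit length at most \<open>t\<close> plus that of the largest
  constant in the program and of the input registers, and therefore this unit cost measure is
  polynomially related to the running time of deterministic Turing machines.
\<close>

datatype instr =
    Const nat nat    \<comment> \<open>\<open>R d := c\<close>\<close>
  | Add nat nat nat  \<comment> \<open>\<open>R d := R a + R b\<close>\<close>
  | Sub nat nat nat  \<comment> \<open>\<open>R d := R a - R b\<close>, truncated at \<open>0\<close>\<close>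
  | Load nat nat     \<comment> \<open>\<open>R d := R (R a)\<close>\<close>
  | Store nat nat    \<comment> \<open>\<open>R (R d) := R a\<close>\<close>
  | Read nat nat     \<comment> \<open>\<open>R d := inp (R a)\<close>\<close>
  | JumpPos nat nat  \<comment> \<open>if \<open>R a > 0\<close> then continue at instruction \<open>q\<close>\<close>

type_synonym config = "nat \<times> (nat \<Rightarrow> nat)"  \<comment> \<open>program counter and registers\<close>

fun exec :: "(nat \<Rightarrow> nat) \<Rightarrow> instr \<Rightarrow> config \<Rightarrow> config" where
  "exec inp (Const d c) (pc, R) = (pc + 1, R(d := c))"
| "exec inp (Add d a b) (pc, R) = (pc + 1, R(d := R a + R b))"
| "exec inp (Sub d a b) (pc, R) = (pc + 1, R(d := R a - R b))"
| "exec inp (Load d a) (pc, R) = (pc + 1, R(d := R (R a)))"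
| "exec inp (Store d a) (pc, R) = (pc + 1, R(R d := R a))"
| "exec inp (Read d a) (pc, R) = (pc + 1, R(d := inp (R a)))"
| "exec inp (JumpPos a q) (pc, R) = (if R a > 0 then q else pc + 1, R)"

definition halted :: "instr list \<Rightarrow> config \<Rightarrow> bool" where
  "halted prog c \<longleftrightarrow> length prog \<le> fst c"

definition step :: "instr list \<Rightarrow> (nat \<Rightarrow> nat) \<Rightarrow> config \<Rightarrow> config" where
  "step prog inp c = (if halted prog c then c else exec inp (prog ! fst c) c)"

text \<open>
  Input register \<open>0\<close> holds the length of the input word, registers \<open>1, 2, \<dots>\<close> hold its bits.
\<close>

definition input_registers :: "bool list \<Rightarrow> nat \<Rightarrow> nat" where
  "input_registers w i =
     (if i = 0 then length w else if i \<le> length w then of_bool (w ! (i - 1)) else 0)"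

definition run :: "instr list \<Rightarrow> bool list \<Rightarrow> nat \<Rightarrow> config" where
  "run prog w t = (step prog (input_registers w) ^^ t) (0, \<lambda>_. 0)"

text \<open>
  As halted configurations are fixed points of \<^const>\<open>step\<close>, the following two say that the
  program halts after \<^emph>\<open>at most\<close> \<open>t\<close> steps, with nonzero resp. zero contents of register \<open>0\<close>.
\<close>

definition accepts_within :: "instr list \<Rightarrow> bool list \<Rightarrow> nat \<Rightarrow> bool" where
  "accepts_within prog w t \<longleftrightarrow> halted prog (run prog w t) \<and> snd (run prog w t) 0 \<noteq> 0"

definition rejects_within :: "instr list \<Rightarrow> bool list \<Rightarrow> nat \<Rightarrow> bool" where
  "rejects_within prog w t \<longleftrightarrow> halted prog (run prog w t) \<and> snd (run prog w t) 0 = 0"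

text \<open>
  A promise problem is given by its yes-instances and its no-instances. Nothing is required of the
  program on words that are neither.
\<close>

definition promise_solvable_in_polynomial_time :: "bool list set \<Rightarrow> bool list set \<Rightarrow> bool" where
  "promise_solvable_in_polynomial_time Yes No \<longleftrightarrow>
     (\<exists>(prog :: instr list) (p :: nat poly).
        (\<forall>w\<in>Yes. accepts_within prog w (poly p (length w))) \<and>
        (\<forall>w\<in>No. rejects_within prog w (poly p (length w))))"


section \<open>Graphs as inputs\<close>

text \<open>
  A graph is given by its adjacency matrix, written row by row, with respect to an arbitrary
  enumeration of its vertices. Natural numbers as vertices suffice, since the matrix of a
  graph depends only on its isomorphism type and on the enumeration.
\<close>

definition adjacency_word :: "'a pair_pre_digraph \<Rightarrow> 'a list \<Rightarrow> bool list" where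
  "adjacency_word G vs = concat (map (\<lambda>u. map (\<lambda>v. (u, v) \<in> parcs G) vs) vs)"

definition graph_words :: "nat pair_pre_digraph set \<Rightarrow> bool list set" where
  "graph_words \<G> = {adjacency_word G vs | G vs. G \<in> \<G> \<and> distinct vs \<and> set vs = pverts G}"

end

theory Submission
  imports Defs
begin

text \<open>
  Let \<open>M\<close> be a maximal independent set of a (1,\<open>l\<close>)-graph with independent part \<open>S\<close>, and let
  \<open>k = 2 l + 1\<close>. For a tuple \<open>t\<close> of \<open>k\<close> vertices, run the greedy algorithm on \<open>t\<close>, then on \<open>M\<close>,
  then on all vertices. Every outcome is a maximal independent set, so in a well-covered graph all
  of them have size \<open>|M|\<close>. Conversely, suppose that they all have this size. Exchanging \<open>l + 1\<close>
  vertices of \<open>S - M\<close> into \<open>M\<close> would remove at most the \<open>l\<close> vertices of \<open>M - S\<close>, hence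
  \<open>|S - M| \<le> l\<close>. Therefore any maximal independent set \<open>I\<close> satisfies
  \<open>|I - M| \<le> |I - S| + |S - M| \<le> 2 l\<close>, and the greedy algorithm started with \<open>I - M\<close> returns \<open>I\<close>,
  so that \<open>|I| = |M|\<close>. The test does not refer to a partition, and there are only \<open>n ^ k\<close> tuples.
\<close>

section \<open>Greedy independent sets\<close>

text \<open>Inserting a member of \<open>X\<close> again changes nothing, so the lists fed to
  \<open>greedy\<close> may contain repetitions.\<close>

definition greedy_insert :: "'a pair_pre_digraph \<Rightarrow> 'a \<Rightarrow> 'a set \<Rightarrow> 'a set" where
  "greedy_insert G v X = (if \<exists>u\<in>X. (u, v) \<in> parcs G then X else insert v X)"

abbreviation greedy :: "'a pair_pre_digraph \<Rightarrow> 'a list \<Rightarrow> 'a set \<Rightarrow> 'a set" where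
  "greedy G \<equiv> fold (greedy_insert G)"

section \<open>Symmetric loop-free arcs and the outcome of the greedy algorithm\<close>

lemma arc_sym: "pair_graph G \<Longrightarrow> (u, v) \<in> parcs G \<Longrightarrow> (v, u) \<in> parcs G"
proof -
  assume "pair_graph G" and uv: "(u, v) \<in> parcs G"
  then interpret pair_graph G by simp
  show ?thesis using sym_arcs uv by (auto simp: symmetric_def arcs_ends_conv sym_def)
qed

lemma arc_irrefl: "pair_graph G \<Longrightarrow> (v, v) \<notin> parcs G"
proof
  assume "pair_graph G" "(v, v) \<in> parcs G"
  then interpret pair_graph G by simp
  show False using no_loops[OF \<open>(v, v) \<in> parcs G\<close>] by simp
qed

lemma finite_pverts: "pair_graph G \<Longrightarrow> finite (pverts G)"
proof -
  assume "pair_graph G"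
  then interpret pair_graph G by simp
  show ?thesis by simp
qed

lemma independent_greedy:
  assumes "pair_graph G" "set xs \<subseteq> pverts G" "independent_set G X"
  shows "independent_set G (greedy G xs X)"
  using assms(2,3)
proof (induction xs arbitrary: X)
  case (Cons v xs)
  have "independent_set G (greedy_insert G v X)"
    using Cons.prems arc_sym[OF assms(1)] arc_irrefl[OF assms(1)]
    by (auto simp: independent_set_def greedy_insert_def)
  then show ?case using Cons by simp
qed simp

lemma greedy_increasing: "X \<subseteq> greedy G xs X"
proof (induction xs arbitrary: X)
  case (Cons v xs)
  have "X \<subseteq> greedy_insert G v X" by (auto simp: greedy_insert_def)
  also have "\<dots> \<subseteq> greedy G xs (greedy_insert G v X)" by (rule Cons)
  finally show ?case by simp
qed simp

lemma greedy_subset: "greedy G xs X \<subseteq> X \<union> set xs"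
proof (induction xs arbitrary: X)
  case (Cons v xs)
  have "greedy G xs (greedy_insert G v X) \<subseteq> greedy_insert G v X \<union> set xs" by (rule Cons)
  moreover have "greedy_insert G v X \<subseteq> insert v X" by (auto simp: greedy_insert_def)
  ultimately show ?case by auto
qed simp

text \<open>When its turn comes, a vertex is either inserted or has a neighbour among those already
  chosen. The chosen set only grows, so either witness persists to the end.\<close>

lemma greedy_blocks:
  assumes "v \<in> set xs"
  shows "v \<in> greedy G xs X \<or> (\<exists>u\<in>greedy G xs X. (u, v) \<in> parcs G)"
  using assms
proof (induction xs arbitrary: X)
  case (Cons w xs)
  show ?case
  proof (cases "v = w")
    case True
    then have "v \<in> greedy_insert G w X \<or> (\<exists>u\<in>greedy_insert G w X. (u, v) \<in> parcs G)"
      by (auto simp: greedy_insert_def)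
    then show ?thesis
      using greedy_increasing[of "greedy_insert G w X" G xs] by auto
  next
    case False
    then show ?thesis using Cons by simp
  qed
qed simp

text \<open>A vertex of \<open>J\<close> that the algorithm rejected has a neighbour in the outcome,
  hence in \<open>J\<close>, contradicting the independence of \<open>J\<close>.\<close>

lemma maximal_greedy:
  assumes "pair_graph G" "set xs = pverts G" "independent_set G X"
  shows "maximal_independent_set G (greedy G xs X)"
  unfolding maximal_independent_set_def
proof (intro conjI allI impI)
  show "independent_set G (greedy G xs X)"
    using independent_greedy assms by blast
next
  fix J assume J: "independent_set G J" "greedy G xs X \<subseteq> J"
  have "v \<in> greedy G xs X" if "v \<in> J" for v
    using greedy_blocks[of v xs G X] that J assms(2) unfolding independent_set_def by blast
  then show "J = greedy G xs X" using J(2) by blast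
qed

text \<open>Being independent, \<open>ts\<close> is taken completely. A later \<open>m\<close> could
  only be blocked from \<open>ts\<close>, which is excluded, or from \<open>ms\<close>, which is
  independent. Processing \<open>xs\<close> afterwards removes nothing.\<close>

lemma exchange_subset_greedy:
  assumes "pair_graph G" "independent_set G (set ts)" "independent_set G (set ms)"
  shows "set ts \<union> {m \<in> set ms. \<forall>t\<in>set ts. (t, m) \<notin> parcs G} \<subseteq> greedy G (ts @ ms @ xs) {}"
proof -
  let ?A = "greedy G ts {}" and ?B = "greedy G ms (greedy G ts {})"
  have A: "?A \<subseteq> set ts" using greedy_subset[of G ts "{}"] by simp
  then have ts: "set ts \<subseteq> ?A"
    using greedy_blocks[of _ ts G "{}"] assms(2) unfolding independent_set_def by blast
  have B: "?B \<subseteq> set ts \<union> set ms" using greedy_subset[of G ms ?A] A by blast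
  have ms: "m \<in> ?B" if "m \<in> set ms" "\<forall>t\<in>set ts. (t, m) \<notin> parcs G" for m
    using greedy_blocks[OF that(1), of G ?A] B that assms(3) unfolding independent_set_def by blast
  have "?A \<subseteq> ?B" by (rule greedy_increasing)
  then have "set ts \<union> {m \<in> set ms. \<forall>t\<in>set ts. (t, m) \<notin> parcs G} \<subseteq> ?B"
    using ts ms by blast
  also have "?B \<subseteq> greedy G xs ?B" by (rule greedy_increasing)
  finally show ?thesis by simp
qed

section \<open>Partitions and the greedy criterion for well-coveredness\<close>

text \<open>Outside \<open>P 0\<close> there are only \<open>l\<close> cliques, and each shares at
  most one vertex with an independent set.\<close>

lemma card_independent_diff:
  assumes "kl_partition 1 l G P" "independent_set G I" "finite I"
  shows "card (I - P 0) \<le> l"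
proof -
  have I: "I - P 0 \<subseteq> (\<Union>i\<in>{1..<1 + l}. I \<inter> P i)"
  proof
    fix x assume x: "x \<in> I - P 0"
    then have "x \<in> (\<Union>i<1 + l. P i)"
      using assms(1,2) unfolding kl_partition_def independent_set_def by blast
    then obtain i where "i < 1 + l" "x \<in> P i" by blast
    moreover from this x have "i \<noteq> 0" by (metis Diff_iff)
    ultimately show "x \<in> (\<Union>i\<in>{1..<1 + l}. I \<inter> P i)" using x by auto
  qed
  have "card (I \<inter> P i) \<le> 1" if "i \<in> {1..<1 + l}" for i
  proof -
    have "clique G (P i)" using assms(1) that unfolding kl_partition_def by blast
    then have "\<forall>x\<in>I \<inter> P i. \<forall>y\<in>I \<inter> P i. x = y"
      using assms(2) unfolding clique_def independent_set_def by blast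
    then show ?thesis
      using assms(3) by (simp add: card_le_Suc0_iff_eq)
  qed
  then have "(\<Sum>i\<in>{1..<1 + l}. card (I \<inter> P i)) \<le> (\<Sum>i\<in>{1..<1 + l}. 1)" by (intro sum_mono) auto
  moreover have "card (\<Union>i\<in>{1..<1 + l}. I \<inter> P i) \<le> (\<Sum>i\<in>{1..<1 + l}. card (I \<inter> P i))"
    by (rule card_UN_le) simp
  moreover have "card (I - P 0) \<le> card (\<Union>i\<in>{1..<1 + l}. I \<inter> P i)"
    using assms(3) I by (intro card_mono) auto
  ultimately show ?thesis by simp
qed

text \<open>Padding with a repeated element lets tuples of the fixed length \<open>k\<close> stand
  for all nonempty sets of size at most \<open>k\<close>. Nonemptiness supplies the element to
  repeat.\<close>

lemma list_of_small_set:
  assumes "finite A" "A \<noteq> {}" "card A \<le> k"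
  obtains xs where "set xs = A" "length xs = k"
proof -
  obtain ys where ys: "set ys = A" "distinct ys"
    using finite_distinct_list[OF assms(1)] by blast
  have "length ys \<le> k" using ys assms(3) distinct_card by metis
  moreover have "ys \<noteq> []" using ys assms(2) by auto
  ultimately have "set (ys @ replicate (k - length ys) (hd ys)) = A"
    "length (ys @ replicate (k - length ys) (hd ys)) = k"
    using ys(1) by (auto simp: set_replicate_conv_if)
  then show ?thesis by (rule that)
qed

theorem well_covered_iff_greedy:
  assumes G: "pair_graph G" and P: "kl_partition 1 l G P"
    and vs: "set vs = pverts G" and ms: "maximal_independent_set G (set ms)"
    and k: "2 * l + 1 \<le> k"
  shows "well_covered G \<longleftrightarrow>
    (\<forall>ts. set ts \<subseteq> pverts G \<longrightarrow> length ts = k \<longrightarrow>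
       card (greedy G (ts @ ms @ vs) {}) = card (set ms))"
    (is "_ \<longleftrightarrow> ?R")
proof
  assume wc: "well_covered G"
  show ?R
  proof (intro allI impI)
    fix ts assume "set ts \<subseteq> pverts G"
    then have "independent_set G (greedy G (ts @ ms) {})"
      using ms by (intro independent_greedy[OF G])
        (auto simp: maximal_independent_set_def independent_set_def)
    then have "maximal_independent_set G (greedy G vs (greedy G (ts @ ms) {}))"
      by (rule maximal_greedy[OF G vs])
    then show "card (greedy G (ts @ ms @ vs) {}) = card (set ms)"
      using wc[unfolded well_covered_def, rule_format, OF _ ms] by simp
  qed
next
  assume R: ?R
  define M where "M = set ms"
  have M: "independent_set G M" and finM: "finite M"
    using ms by (auto simp: M_def maximal_independent_set_def)
  have S: "independent_set G (P 0)" using P by (simp add: kl_partition_def)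
  have fin: "finite I" if "independent_set G I" for I
    using that finite_pverts[OF G] by (auto simp: independent_set_def intro: finite_subset)
  \<comment> \<open>Used twice: with \<open>T\<close> inside \<open>P 0 - M\<close> to bound that
    difference, and with \<open>T = I - M\<close> to recover \<open>I\<close>.\<close>
  have exch: "\<exists>J. independent_set G J \<and> card J = card M \<and>
      T \<union> {m \<in> M. \<forall>t\<in>T. (t, m) \<notin> parcs G} \<subseteq> J"
    if T: "independent_set G T" "T \<noteq> {}" "card T \<le> k" for T
  proof -
    obtain ts where ts: "set ts = T" "length ts = k"
      using list_of_small_set[OF fin[OF T(1)] T(2,3)] by metis
    let ?J = "greedy G (ts @ ms @ vs) {}"
    have "set (ts @ ms @ vs) \<subseteq> pverts G"
      using T(1) M ts(1) vs by (auto simp: independent_set_def M_def)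
    then have "independent_set G ?J"
      by (rule independent_greedy[OF G]) (simp add: independent_set_def)
    moreover have "card ?J = card M"
      using R ts T(1) unfolding independent_set_def M_def by blast
    ultimately show ?thesis
      using exchange_subset_greedy[OF G, of ts ms vs] T(1) M ts(1) unfolding M_def by blast
  qed
  have SM: "card (P 0 - M) \<le> l"
  proof (rule ccontr)
    assume "\<not> card (P 0 - M) \<le> l"
    \<comment> \<open>One vertex more than the at most \<open>l\<close> vertices of
      \<open>M - P 0\<close> that bringing in \<open>T\<close> can cost.\<close>
    then obtain T where T: "T \<subseteq> P 0 - M" "card T = Suc l" "finite T"
      using obtain_subset_with_card_n[of "Suc l" "P 0 - M"] by (metis not_less_eq_eq)
    have indT: "independent_set G T" using S T(1) unfolding independent_set_def by blast
    have "T \<noteq> {}" using T(2) by auto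
    then obtain J where J: "independent_set G J" "card J = card M"
      "T \<union> {m \<in> M. \<forall>t\<in>T. (t, m) \<notin> parcs G} \<subseteq> J"
      using exch[OF indT] T(2) k by auto
    \<comment> \<open>\<open>M - (M - P 0)\<close> is the part of \<open>M\<close> inside
      \<open>P 0\<close>, written so that \<open>card_Diff_subset\<close> applies. It survives the
      exchange because \<open>T\<close> also lies in the independent set \<open>P 0\<close>.\<close>
    have "M - (M - P 0) \<subseteq> {m \<in> M. \<forall>t\<in>T. (t, m) \<notin> parcs G}"
      using S T(1) unfolding independent_set_def by blast
    then have "T \<union> (M - (M - P 0)) \<subseteq> J" using J(3) by blast
    then have "card (T \<union> (M - (M - P 0))) \<le> card J"
      by (rule card_mono[OF fin[OF J(1)]])
    moreover have "card (T \<union> (M - (M - P 0))) = card T + card (M - (M - P 0))"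
      using T finM by (intro card_Un_disjoint) auto
    moreover have "card (M - (M - P 0)) = card M - card (M - P 0)"
      using finM by (intro card_Diff_subset) auto
    moreover have "card (M - P 0) \<le> l" by (rule card_independent_diff[OF P M finM])
    ultimately show False using J(2) T(2) by linarith
  qed
  have "card I = card M" if I: "maximal_independent_set G I" for I
  \<comment> \<open>The case \<open>I \<subseteq> M\<close> is separate because \<open>exch\<close>
    needs a nonempty \<open>T\<close>; there the maximality of \<open>I\<close> already gives
    \<open>I = M\<close>.\<close>
  proof (cases "I \<subseteq> M")
    case True
    then show ?thesis using I M unfolding maximal_independent_set_def by blast
  next
    case False
    have indI: "independent_set G I" using I by (simp add: maximal_independent_set_def)
    have "card (I - M) \<le> card ((I - P 0) \<union> (P 0 - M))"
      using fin[OF indI] fin[OF S] by (intro card_mono) auto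
    also have "\<dots> \<le> card (I - P 0) + card (P 0 - M)" by (rule card_Un_le)
    also have "\<dots> \<le> l + l"
      using SM card_independent_diff[OF P indI fin[OF indI]] by linarith
    finally have "card (I - M) \<le> k" using k by linarith
    moreover have "independent_set G (I - M)" using indI unfolding independent_set_def by blast
    moreover have "I - M \<noteq> {}" using False by blast
    ultimately obtain J where J: "independent_set G J" "card J = card M"
      "I - M \<union> {m \<in> M. \<forall>t\<in>I - M. (t, m) \<notin> parcs G} \<subseteq> J"
      using exch by blast
    \<comment> \<open>Members of \<open>I\<close> in \<open>M\<close> have no neighbour in
      \<open>I - M\<close>, so they lie in \<open>J\<close> together with
      \<open>I - M\<close>.\<close>
    have "I \<subseteq> J" using J(3) indI unfolding independent_set_def by blast
    then have "J = I" using I J(1) unfolding maximal_independent_set_def by blast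
    then show ?thesis using J(2) by simp
  qed
  then show "well_covered G" unfolding well_covered_def by simp
qed

section \<open>Structured programs\<close>

text \<open>The control structures are the two that \<open>JumpPos\<close> implements with a single
  jump: skipping on a positive register, and a loop that tests after its body and so runs at least
  once.\<close>

datatype com =
    Basic "instr list"
  | Seq com com (infixr ";;" 60)
  | Unless nat com
  | Repeat com nat

fun code_size :: "com \<Rightarrow> nat" where
  "code_size (Basic is) = length is"
| "code_size (c ;; d) = code_size c + code_size d"
| "code_size (Unless r c) = code_size c + 1"
| "code_size (Repeat c r) = code_size c + 1"

text \<open>Jump targets are absolute, so compilation carries the address \<open>a\<close> of the
  first instruction.\<close>

fun code :: "nat \<Rightarrow> com \<Rightarrow> instr list" where
  "code a (Basic is) = is"
| "code a (c ;; d) = code a c @ code (a + code_size c) d"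
| "code a (Unless r c) = JumpPos r (a + 1 + code_size c) # code (a + 1) c"
| "code a (Repeat c r) = code a c @ [JumpPos r a]"

lemma length_code: "length (code a c) = code_size c"
  by (induction c arbitrary: a) auto

text \<open>
  Quantifying over the surrounding program makes the rule for sequences compositional.
\<close>

definition wp :: "(nat \<Rightarrow> nat) \<Rightarrow> com \<Rightarrow> nat \<Rightarrow> ((nat \<Rightarrow> nat) \<Rightarrow> bool) \<Rightarrow> (nat \<Rightarrow> nat) \<Rightarrow> bool" where
  "wp inp c T Q R \<longleftrightarrow> (\<forall>pre suf. \<exists>t\<le>T. \<exists>R'.
     (step (pre @ code (length pre) c @ suf) inp ^^ t) (length pre, R) =
       (length pre + code_size c, R') \<and> Q R')"

lemma wpE:
  assumes "wp inp c T Q R" "prog = pre @ code (length pre) c @ suf"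
  obtains t R' where "t \<le> T"
    "(step prog inp ^^ t) (length pre, R) = (length pre + code_size c, R')" "Q R'"
  using assms unfolding wp_def by blast

lemma wp_mono:
  assumes "wp inp c T Q R" "T \<le> T'" "\<And>R'. Q R' \<Longrightarrow> Q' R'"
  shows "wp inp c T' Q' R"
  unfolding wp_def
proof (intro allI)
  fix pre suf :: "instr list"
  obtain t R' where "t \<le> T" "(step (pre @ code (length pre) c @ suf) inp ^^ t) (length pre, R) =
       (length pre + code_size c, R')" "Q R'"
    using assms(1) unfolding wp_def by blast
  then show "\<exists>t\<le>T'. \<exists>R'. (step (pre @ code (length pre) c @ suf) inp ^^ t) (length pre, R) =
       (length pre + code_size c, R') \<and> Q' R'"
    using assms(2,3) by (meson le_trans)
qed

section \<open>Rules for time-bounded total correctness\<close>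

fun is_jump :: "instr \<Rightarrow> bool" where
  "is_jump (JumpPos _ _) = True"
| "is_jump _ = False"

text \<open>The program counter 0 is arbitrary: the register part of \<open>exec\<close> does not
  depend on it.\<close>

definition update :: "(nat \<Rightarrow> nat) \<Rightarrow> instr \<Rightarrow> (nat \<Rightarrow> nat) \<Rightarrow> (nat \<Rightarrow> nat)" where
  "update inp i R = snd (exec inp i (0, R))"

lemma update_simps [simp]:
  "update inp (Const d c) R = R(d := c)"
  "update inp (Add d a b) R = R(d := R a + R b)"
  "update inp (Sub d a b) R = R(d := R a - R b)"
  "update inp (Load d a) R = R(d := R (R a))"
  "update inp (Store d a) R = R(R d := R a)"
  "update inp (Read d a) R = R(d := inp (R a))"
  by (simp_all add: update_def)

lemma exec_update: "\<not> is_jump i \<Longrightarrow> exec inp i (pc, R) = (pc + 1, update inp i R)"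
  by (cases i) auto

lemma step_at: "step (pre @ i # suf) inp (length pre, R) = exec inp i (length pre, R)"
  by (simp add: step_def halted_def)

lemma wp_Basic:
  assumes "\<forall>i\<in>set is. \<not> is_jump i" "length is \<le> T" "Q (fold (update inp) is R)"
  shows "wp inp (Basic is) T Q R"
proof -
  have "(step (pre @ is @ suf) inp ^^ length is) (length pre, R) =
      (length pre + length is, fold (update inp) is R)" for pre suf
    using assms(1)
  proof (induction "is" arbitrary: pre R)
    case (Cons i "is")
    \<comment> \<open>The first instruction is moved into the prefix, so that the induction
      hypothesis applies one address further.\<close>
    have "(step (pre @ (i # is) @ suf) inp ^^ length (i # is)) (length pre, R) =
        (step ((pre @ [i]) @ is @ suf) inp ^^ length is)
          (step (pre @ i # is @ suf) inp (length pre, R))"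
      by (simp only: length_Cons funpow_Suc_right o_apply) simp
    also have "\<dots> = (step ((pre @ [i]) @ is @ suf) inp ^^ length is)
          (length (pre @ [i]), update inp i R)"
      using Cons.prems by (simp add: step_at exec_update del: append_assoc)
    also have "\<dots> = (length (pre @ [i]) + length is, fold (update inp) is (update inp i R))"
      using Cons.prems by (intro Cons.IH) simp
    finally show ?case by simp
  qed simp
  then show ?thesis using assms(2,3) unfolding wp_def by auto
qed

lemma wp_Seq:
  assumes "wp inp c T (wp inp d U Q) R"
  shows "wp inp (c ;; d) (T + U) Q R"
  unfolding wp_def
proof (intro allI)
  fix pre suf :: "instr list"
  let ?d = "code (length pre + code_size c) d"
  let ?prog = "pre @ code (length pre) (c ;; d) @ suf"
  \<comment> \<open>One program is split in two ways: the code of \<open>d\<close> belongs to the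
    suffix of \<open>c\<close>, and the code of \<open>c\<close> to the prefix of
    \<open>d\<close>.\<close>
  have c: "?prog = pre @ code (length pre) c @ (?d @ suf)" by simp
  have d: "?prog = (pre @ code (length pre) c) @ code (length (pre @ code (length pre) c)) d @ suf"
    by (simp add: length_code)
  obtain t R' where t: "t \<le> T" "(step ?prog inp ^^ t) (length pre, R) =
      (length pre + code_size c, R')" "wp inp d U Q R'"
    using assms c by (rule wpE)
  obtain u R'' where u: "u \<le> U" "(step ?prog inp ^^ u) (length pre + code_size c, R') =
      (length pre + code_size c + code_size d, R'')" "Q R''"
    using wpE[OF t(3) d] by (auto simp: length_code)
  have "(step ?prog inp ^^ (u + t)) (length pre, R) =
      (length pre + code_size (c ;; d), R'')"
    unfolding funpow_add o_apply t(2) u(2) by simp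
  then show "\<exists>t\<le>T + U. \<exists>R'. (step ?prog inp ^^ t) (length pre, R) =
      (length pre + code_size (c ;; d), R') \<and> Q R'"
    using t(1) u(1,3) by (metis add.commute add_mono)
qed

text \<open>The separate premise for \<open>R'\<close> allows the state after the block to be
  supplied in simplified form before \<open>c\<close> is treated.\<close>

lemma wp_Basic_Seq:
  assumes "\<forall>i\<in>set is. \<not> is_jump i" "length is \<le> T" "fold (update inp) is R = R'"
    "wp inp c U P R'"
  shows "wp inp (Basic is ;; c) (T + U) P R"
  by (rule wp_Seq, rule wp_Basic) (use assms in auto)

lemma wp_Unless:
  assumes "R r > 0 \<Longrightarrow> Q R" "R r = 0 \<Longrightarrow> wp inp c T Q R"
  shows "wp inp (Unless r c) (T + 1) Q R"
  unfolding wp_def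
proof (intro allI)
  fix pre suf :: "instr list"
  let ?j = "JumpPos r (length pre + 1 + code_size c)"
  let ?prog = "pre @ code (length pre) (Unless r c) @ suf"
  have prog: "?prog = (pre @ [?j]) @ code (length (pre @ [?j])) c @ suf" by simp
  have step: "step ?prog inp (length pre, R) = exec inp ?j (length pre, R)"
    by (simp add: step_at)
  show "\<exists>t\<le>T + 1. \<exists>R'. (step ?prog inp ^^ t) (length pre, R) =
      (length pre + code_size (Unless r c), R') \<and> Q R'"
  proof (cases "R r > 0")
    case True
    then have "(step ?prog inp ^^ 1) (length pre, R) = (length pre + code_size (Unless r c), R)"
      using step by simp
    then show ?thesis using assms(1)[OF True] by (meson le_add2)
  next
    case False
    then obtain t R' where t: "t \<le> T" "(step ?prog inp ^^ t) (length (pre @ [?j]), R) =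
        (length (pre @ [?j]) + code_size c, R')" "Q R'"
      using wpE[OF assms(2) prog] by auto
    have "(step ?prog inp ^^ Suc t) (length pre, R) = (length pre + code_size (Unless r c), R')"
      unfolding funpow_Suc_right o_apply step using False t(2) by simp
    then show ?thesis using t(1,3) by (metis Suc_eq_plus1 Suc_le_mono)
  qed
qed

text \<open>The invariant is indexed by the number of rounds left. \<open>n > 0\<close> reflects
  that the body precedes the first test, and each round pays one step for the jump.\<close>

lemma wp_Repeat:
  assumes "n > 0" "Inv n R"
    "\<And>i R. i < n \<Longrightarrow> Inv (Suc i) R \<Longrightarrow> wp inp c T (\<lambda>R'. Inv i R' \<and> (R' r > 0 \<longleftrightarrow> i > 0)) R"
    "\<And>R. Inv 0 R \<Longrightarrow> Q R"
  shows "wp inp (Repeat c r) (n * (T + 1)) Q R"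
  unfolding wp_def
proof (intro allI)
  fix pre suf :: "instr list"
  let ?prog = "pre @ code (length pre) (Repeat c r) @ suf"
  have prog: "?prog = pre @ code (length pre) c @ (JumpPos r (length pre) # suf)" by simp
  have jump: "step ?prog inp (length pre + code_size c, R) =
      exec inp (JumpPos r (length pre)) (length pre + code_size c, R)" for R
    using step_at[of "pre @ code (length pre) c" "JumpPos r (length pre)" suf inp R]
    by (simp add: length_code)
  have "\<exists>t\<le>m * (T + 1). \<exists>R'. (step ?prog inp ^^ t) (length pre, R) =
      (length pre + code_size (Repeat c r), R') \<and> Q R'" if "0 < m" "m \<le> n" "Inv m R" for m R
    using that
  proof (induction m arbitrary: R)
    case (Suc m)
    then have "wp inp c T (\<lambda>R'. Inv m R' \<and> (R' r > 0 \<longleftrightarrow> m > 0)) R"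
      using assms(3)[of m R] by simp
    then obtain t R' where t: "t \<le> T" "(step ?prog inp ^^ t) (length pre, R) =
        (length pre + code_size c, R')" "Inv m R' \<and> (R' r > 0 \<longleftrightarrow> m > 0)"
      using prog by (rule wpE)
    have t': "(step ?prog inp ^^ Suc t) (length pre, R) =
        exec inp (JumpPos r (length pre)) (length pre + code_size c, R')"
      by (simp only: funpow.simps o_apply t(2) jump)
    show ?case
    proof (cases "m = 0")
      case True
      then have "(step ?prog inp ^^ Suc t) (length pre, R) =
          (length pre + code_size (Repeat c r), R')"
        unfolding t' using t(3) by simp
      then show ?thesis using True t(1,3) assms(4) by (intro exI[of _ "Suc t"]) auto
    next
      case False
      then have pc: "(step ?prog inp ^^ Suc t) (length pre, R) = (length pre, R')"
        unfolding t' using t(3) by simp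
      obtain s R'' where s: "s \<le> m * (T + 1)" "(step ?prog inp ^^ s) (length pre, R') =
          (length pre + code_size (Repeat c r), R'')" "Q R''"
        using Suc.IH[of R'] False Suc.prems t(3) by auto
      have "(step ?prog inp ^^ (s + Suc t)) (length pre, R) =
          (length pre + code_size (Repeat c r), R'')"
        unfolding funpow_add o_apply pc s(2) ..
      moreover have "s + Suc t \<le> Suc m * (T + 1)" using s(1) t(1) by simp
      ultimately show ?thesis using s(3) by blast
    qed
  qed simp
  then show "\<exists>t\<le>n * (T + 1). \<exists>R'. (step ?prog inp ^^ t) (length pre, R) =
      (length pre + code_size (Repeat c r), R') \<and> Q R'"
    using assms(1,2) by blast
qed

text \<open>Halted configurations are fixed points, so running for the full bound \<open>T\<close>
  ends in the state that was reached within it.\<close>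

lemma wp_halts:
  assumes "wp inp c T Q (\<lambda>_. 0)" "inp = input_registers w"
  shows "halted (code 0 c) (run (code 0 c) w T) \<and> Q (snd (run (code 0 c) w T))"
proof -
  obtain t R' where t: "t \<le> T"
    "(step (code 0 c) inp ^^ t) (0, \<lambda>_. 0) = (code_size c, R')" "Q R'"
    using assms(1)[unfolded wp_def, rule_format, of "[]" "[]"] by auto
  have halt: "halted (code 0 c) (code_size c, R')" by (simp add: halted_def length_code)
  have "(step (code 0 c) inp ^^ s) (code_size c, R') = (code_size c, R')" for s
    by (induction s) (use halt in \<open>simp_all add: step_def\<close>)
  then have "run (code 0 c) w (T - t + t) = (code_size c, R')"
    unfolding run_def funpow_add o_apply using t(2) assms(2) by simp
  then show ?thesis using t halt by simp
qed

section \<open>The decision program\<close>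

text \<open>
  Memory layout. The \<open>k\<close> registers from 21 on are the counters of the nested loops and hold the
  tuple that is tried first; they are followed by \<open>n\<close> registers for \<open>M\<close>, by \<open>n\<close> registers
  for all the vertices, and by the indicator of the set built by the greedy algorithm. Vertices are
  numbered from 1. In the first two blocks 0 stands for no vertex; inserting it only writes to the
  cell of index 0, which is never read.
\<close>

abbreviation (input) "ONE \<equiv> 2::nat"
abbreviation (input) "LEN \<equiv> 3::nat"
abbreviation (input) "ORD \<equiv> 4::nat"
abbreviation (input) "CELLS \<equiv> 5::nat"
abbreviation (input) "SLOTS \<equiv> 6::nat"
abbreviation (input) "SIZE0 \<equiv> 7::nat"
abbreviation (input) "IDX \<equiv> 8::nat"
abbreviation (input) "VTX \<equiv> 9::nat"
abbreviation (input) "NBR \<equiv> 10::nat"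
abbreviation (input) "ADR \<equiv> 11::nat"
abbreviation (input) "ENT \<equiv> 12::nat"
abbreviation (input) "TMP \<equiv> 13::nat"
abbreviation (input) "PTR \<equiv> 14::nat"
abbreviation (input) "CONF \<equiv> 15::nat"
abbreviation (input) "CNT \<equiv> 16::nat"
abbreviation (input) "SIZE \<equiv> 17::nat"
abbreviation (input) "MBASE \<equiv> 18::nat"
abbreviation (input) "ABASE \<equiv> 19::nat"
abbreviation (input) "BAD \<equiv> 20::nat"
abbreviation (input) "BASE \<equiv> 21::nat"

text \<open>The counter starts at the content of \<open>m\<close>, decreases to 1 during the rounds
  and is 0 on exit. \<open>Const\<close> followed by \<open>Add\<close> is a copy, and the decrement
  relies on \<open>ONE\<close> holding 1.\<close>

definition For :: "nat \<Rightarrow> nat \<Rightarrow> com \<Rightarrow> com" where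
  "For r m c = Basic [Const r 0, Add r r m] ;; Repeat (c ;; Basic [Sub r r ONE]) r"

text \<open>\<open>Inv i\<close> is the state in which the indices from \<open>i\<close> down to 1
  are still to be processed. The update \<open>r := i - 1\<close> anticipates the decrement after
  the body. \<open>m \<noteq> r\<close> is required because \<open>r\<close> is cleared before
  \<open>m\<close> is added to it.\<close>

lemma wp_For:
  assumes "R m = n" "0 < n" "m \<noteq> r" "Inv n (R(r := n))"
    "\<And>i R. \<lbrakk>1 \<le> i; i \<le> n; Inv i R; R r = i\<rbrakk> \<Longrightarrow>
       wp inp c T (\<lambda>R'. R' r = i \<and> R' ONE = 1 \<and> Inv (i - 1) (R'(r := i - 1))) R"
    "\<And>R. Inv 0 R \<Longrightarrow> P R"
  shows "wp inp (For r m c) (2 + n * (T + 2)) P R"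
proof -
  have body: "wp inp (c ;; Basic [Sub r r ONE]) (T + 1)
      (\<lambda>R'. (Inv i R' \<and> R' r = i) \<and> (R' r > 0 \<longleftrightarrow> i > 0)) R"
    if "i < n" "Inv (Suc i) R \<and> R r = Suc i" for i R
    by (rule wp_Seq, rule wp_mono[OF assms(5)[of "Suc i"]])
      (use that in \<open>auto intro!: wp_Basic\<close>)
  have loop: "wp inp (Repeat (c ;; Basic [Sub r r ONE]) r) (n * (T + 1 + 1)) P (R(r := n))"
    using assms(2,4,6) body
    by (intro wp_Repeat[where Inv = "\<lambda>i R. Inv i R \<and> R r = i"]) auto
  show ?thesis
    unfolding For_def
    by (rule wp_Seq, rule wp_Basic) (use loop assms(1,3) in simp_all)
qed

text \<open>A frame condition: \<open>Z\<close> collects the registers that a program piece may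
  overwrite.\<close>

definition same :: "nat set \<Rightarrow> (nat \<Rightarrow> nat) \<Rightarrow> (nat \<Rightarrow> nat) \<Rightarrow> bool" where
  "same Z R R' \<longleftrightarrow> (\<forall>r. r \<notin> Z \<longrightarrow> R' r = R r)"

lemma sameD: "same Z R R' \<Longrightarrow> r \<notin> Z \<Longrightarrow> R' r = R r"
  by (simp add: same_def)

text \<open>
  By symmetry the row of the new vertex is read as a column, from its last entry. Since subtraction
  is truncated, cell plus arc minus 1 is nonzero only at a neighbour that has been chosen before.
\<close>

definition insert_com :: com where
  "insert_com =
     Basic [Add ADR VTX LEN, Const CONF 0] ;;
     For NBR ORD (Basic [Sub ADR ADR ORD, Read ENT ADR, Add PTR CELLS NBR, Load TMP PTR,
       Add TMP TMP ENT, Sub TMP TMP ONE,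
       Add CONF CONF TMP]) ;;
     Basic [Add PTR CELLS VTX] ;;
     Unless CONF (Basic [Store PTR ONE])"

text \<open>While \<open>IDX\<close> decreases from \<open>SLOTS\<close>, the address
  \<open>CELLS - IDX\<close> runs upwards from 21: first the tuple, then \<open>M\<close>, then all
  vertices.\<close>

definition greedy_com :: com where
  "greedy_com = For IDX SLOTS (Basic [Sub VTX CELLS IDX, Load VTX VTX] ;; insert_com)"

text \<open>Counting also clears the indicator, so the next greedy run starts from the empty set;
  \<open>ENT\<close> supplies the zero.\<close>

definition count_com :: com where
  "count_com =
     Basic [Const SIZE 0, Const ENT 0] ;;
     For CNT ORD (Basic [Add PTR CELLS CNT, Load TMP PTR, Add SIZE SIZE TMP, Store PTR ENT])"

text \<open>Both truncated differences are added to \<open>BAD\<close>; they vanish together exactly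
  when the sizes agree.\<close>

definition check_com :: com where
  "check_com = greedy_com ;; count_com ;;
     Basic [Sub TMP SIZE SIZE0, Add BAD BAD TMP, Sub TMP SIZE0 SIZE, Add BAD BAD TMP]"

text \<open>The nesting is part of the program text, which is legitimate because \<open>k\<close> is
  a constant independent of the input.\<close>

primrec nest_com :: "nat \<Rightarrow> com" where
  "nest_com 0 = check_com"
| "nest_com (Suc j) = For (BASE + j) ORD (nest_com j)"

text \<open>The input length is the sum of the first \<open>n\<close> odd numbers.\<close>

definition sqrt_com :: com where
  "sqrt_com =
     Basic [Const ORD 0, Const ADR 0, Add ADR ADR LEN, Const ENT 1] ;;
     Repeat (Basic [Sub ADR ADR ENT, Add ORD ORD ONE, Add ENT ENT ONE, Add ENT ENT ONE]) ADR"

text \<open>\<open>MBASE\<close> and \<open>ABASE\<close> point one below their blocks since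
  vertices are numbered from 1. The extra 1 in \<open>CELLS\<close> provides the cell of index 0,
  and \<open>SLOTS\<close> becomes \<open>CELLS - 21\<close>.\<close>

definition layout_com :: "nat \<Rightarrow> com" where
  "layout_com k =
     Basic [Const MBASE (20 + k), Add ABASE MBASE ORD, Add CELLS ABASE ORD, Add CELLS CELLS ONE,
       Const SLOTS BASE,
       Sub SLOTS CELLS SLOTS] ;;
     For CNT ORD (Basic [Add PTR ABASE CNT, Store PTR CNT])"

text \<open>The indicator is negated into \<open>TMP\<close> because \<open>Unless\<close> skips on
  a positive register.\<close>

definition record_com :: com where
  "record_com =
     For CNT ORD (Basic [Add PTR CELLS CNT, Load TMP PTR, Sub TMP ONE TMP, Add PTR MBASE CNT] ;;
       Unless TMP (Basic [Store PTR CNT]))"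

text \<open>In the first \<open>greedy_com\<close> the slots of the tuple and of \<open>M\<close>
  are still 0, so this run computes \<open>M\<close> itself.\<close>

definition main_com :: "nat \<Rightarrow> com" where
  "main_com k = sqrt_com ;; layout_com k ;; greedy_com ;; record_com ;; count_com ;;
     Basic [Const SIZE0 0, Add SIZE0 SIZE0 SIZE] ;; nest_com k"

text \<open>\<open>IDX\<close> is 1 exactly for the empty word, on which the loops could not be run;
  then \<open>BAD\<close> stays 0. The last instruction outputs 1 if \<open>BAD\<close> is 0, and 0
  otherwise.\<close>

definition decide_com :: "nat \<Rightarrow> com" where
  "decide_com k =
     Basic [Const ONE 1, Read LEN 0, Sub IDX ONE LEN] ;;
     Unless IDX (main_com k) ;;
     Basic [Sub 0 ONE BAD]"

section \<open>Correctness\<close>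

lemma length_concat_map:
  "\<forall>x\<in>set xs. length (g x) = m \<Longrightarrow> length (concat (map g xs)) = length xs * m"
  by (induction xs) auto

lemma nth_concat_map:
  "\<lbrakk>\<forall>x\<in>set xs. length (g x) = m; i < length xs; j < m\<rbrakk> \<Longrightarrow>
    concat (map g xs) ! (i * m + j) = g (xs ! i) ! j"
proof (induction xs arbitrary: i)
  case (Cons x xs)
  then show ?case by (cases i) (auto simp: nth_append algebra_simps)
qed simp

lemma filter_nonzero_map:
  "0 \<notin> set xs \<Longrightarrow> filter (\<lambda>j. j \<noteq> 0) (map (\<lambda>j. if p j then j else 0) xs) = filter p (xs :: nat list)"
  by (induction xs) auto

lemma length_adjacency_word: "length (adjacency_word G vs) = length vs * length vs"
  unfolding adjacency_word_def by (rule length_concat_map) simp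

text \<open>The time bounds keep the unsimplified sums that \<open>wp_Seq\<close>,
  \<open>wp_Unless\<close> and \<open>wp_For\<close> produce, so that the rules match them
  directly.\<close>

definition insert_time :: "nat \<Rightarrow> nat" where
  "insert_time n = 2 + ((2 + n * (7 + 2)) + (1 + (1 + 1)))"

definition greedy_time :: "nat \<Rightarrow> nat \<Rightarrow> nat" where
  "greedy_time k n = 2 + (k + 2 * n) * ((2 + insert_time n) + 2)"

definition count_time :: "nat \<Rightarrow> nat" where
  "count_time n = 2 + (2 + n * (4 + 2))"

primrec nest_time :: "nat \<Rightarrow> nat \<Rightarrow> nat \<Rightarrow> nat" where
  "nest_time k n 0 = greedy_time k n + (count_time n + 4)"
| "nest_time k n (Suc j) = 2 + n * (nest_time k n j + 2)"

definition main_time :: "nat \<Rightarrow> nat \<Rightarrow> nat" where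
  "main_time k n = (4 + n * (4 + 1)) + ((6 + (2 + n * (2 + 2))) + (greedy_time k n +
     ((2 + n * ((4 + (1 + 1)) + 2)) + (count_time n + (2 + nest_time k n k)))))"

definition decide_time :: "nat \<Rightarrow> nat \<Rightarrow> nat" where
  "decide_time k n = 3 + ((main_time k n + 1) + 1)"

text \<open>The empty graph is treated separately, because a \<open>For\<close> loop executes its
  body at least once.\<close>

locale graph_input =
  fixes G :: "'a pair_pre_digraph" and vs :: "'a list" and k :: nat
  assumes G: "pair_graph G" and distinct_vs: "distinct vs" and set_vs: "set vs = pverts G"
    and vs_nonempty: "vs \<noteq> []" and k_pos: "0 < k"
begin

abbreviation n :: nat where "n \<equiv> length vs"

definition vertex :: "nat \<Rightarrow> 'a" where "vertex i = vs ! (i - 1)"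

definition inp :: "nat \<Rightarrow> nat" where "inp = input_registers (adjacency_word G vs)"

text \<open>The address of the cell of index 0, directly behind the slots.\<close>

abbreviation cb :: nat where "cb \<equiv> 21 + k + 2 * n"

lemma n_pos: "0 < n" using vs_nonempty by simp

lemma map_vertex: "map vertex [1..<n + 1] = vs"
proof -
  have "[1..<n + 1] = map Suc [0..<n]" by (metis One_nat_def Suc_eq_plus1 map_Suc_upt)
  moreover have "map (\<lambda>i. vertex (Suc i)) [0..<n] = vs" by (simp add: vertex_def map_nth)
  ultimately show ?thesis by (simp only: map_map comp_def)
qed

lemma vertex_in: "u \<in> {1..n} \<Longrightarrow> vertex u \<in> pverts G"
  unfolding vertex_def set_vs[symmetric] by (intro nth_mem) auto

lemma bij_vertex: "bij_betw vertex {1..n} (pverts G)"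
proof -
  have "vertex ` {1..n} = pverts G"
    using arg_cong[OF map_vertex, of set] set_vs
    by (simp add: atLeastLessThanSuc_atLeastAtMost del: upt_Suc)
  moreover have "inj_on vertex {1..n}"
    using distinct_vs by (auto simp: vertex_def inj_on_def nth_eq_iff_index_eq)
  ultimately show ?thesis by (simp add: bij_betw_def)
qed

lemma vertex_eq_iff: "u \<in> {1..n} \<Longrightarrow> v \<in> {1..n} \<Longrightarrow> vertex u = vertex v \<longleftrightarrow> u = v"
  using bij_vertex by (auto simp: bij_betw_def inj_on_eq_iff)

lemma card_vertex:
  assumes "S \<subseteq> pverts G"
  shows "card {u \<in> {1..n}. vertex u \<in> S} = card S"
proof -
  have "S \<subseteq> vertex ` {1..n}"
    using assms bij_vertex by (simp add: bij_betw_def)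
  then have "vertex ` {u \<in> {1..n}. vertex u \<in> S} = S" by blast
  moreover have "inj_on vertex {u \<in> {1..n}. vertex u \<in> S}"
    using bij_vertex by (auto simp: bij_betw_def inj_on_def)
  ultimately show ?thesis by (metis card_image)
qed

lemma inp_0: "inp 0 = n * n"
  by (simp add: inp_def input_registers_def length_adjacency_word)

text \<open>Rows have length \<open>n\<close>, and the bits start at input register 1, so column
  \<open>v\<close> of row \<open>u\<close> sits at offset \<open>v\<close> after
  \<open>u - 1\<close> full rows.\<close>

lemma inp_arc:
  assumes "u \<in> {1..n}" "v \<in> {1..n}"
  shows "inp (v + (u - 1) * n) = of_bool ((vertex u, vertex v) \<in> parcs G)"
proof -
  have "adjacency_word G vs ! ((u - 1) * n + (v - 1)) =
      map (\<lambda>v. (vs ! (u - 1), v) \<in> parcs G) vs ! (v - 1)"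
    unfolding adjacency_word_def by (rule nth_concat_map) (use assms in auto)
  also have "\<dots> = ((vertex u, vertex v) \<in> parcs G)"
    using assms by (auto simp: vertex_def)
  finally have arc: "adjacency_word G vs ! (v + (u - 1) * n - 1) = ((vertex u, vertex v) \<in> parcs G)"
    using assms by (simp add: add.commute)
  have "(u - 1) * n + n \<le> n * n"
    using assms mult_le_mono1[of u n n] by (cases u) auto
  then have "v + (u - 1) * n \<le> n * n" using assms(2) unfolding atLeastAtMost_iff by linarith
  then show ?thesis
    using assms arc by (simp add: inp_def input_registers_def length_adjacency_word)
qed

section \<open>Register invariants, one greedy run and counting\<close>

definition vars :: "(nat \<Rightarrow> nat) \<Rightarrow> bool" where
  "vars R \<longleftrightarrow> R ONE = 1 \<and> R LEN = n * n \<and> R ORD = n \<and> R CELLS = cb \<and> R SLOTS = k + 2 * n"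

text \<open>Cell 0 is left out, as it absorbs the writes made for slots without a vertex.\<close>

definition cells :: "(nat \<Rightarrow> nat) \<Rightarrow> 'a set \<Rightarrow> bool" where
  "cells R S \<longleftrightarrow> (\<forall>u\<in>{1..n}. R (cb + u) = of_bool (vertex u \<in> S))"

definition process :: "nat \<Rightarrow> 'a set \<Rightarrow> 'a set" where
  "process v S = (if v = 0 then S else greedy_insert G (vertex v) S)"

lemma fold_process:
  "fold process xs S = greedy G (map vertex (filter (\<lambda>v. v \<noteq> 0) xs)) S"
  by (induction xs arbitrary: S) (auto simp: process_def)

lemma wp_insert:
  assumes R: "vars R" "cells R S" "R VTX = v" "v \<le> n" "S \<subseteq> pverts G"
    and P: "\<And>R'. \<lbrakk>same ({NBR, ADR, ENT, TMP, PTR, CONF} \<union> {cb..cb + n}) R R'; cells R' (process v S)\<rbrakk> \<Longrightarrow> P R'"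
  shows "wp inp insert_com (insert_time n) P R"
proof -
  \<comment> \<open>The candidates above \<open>i\<close> have been examined. \<open>CONF\<close> is
    described only for \<open>1 \<le> v\<close>: for \<open>v = 0\<close> the registers read are not
    a column of the matrix, and \<open>CONF\<close> may be anything.\<close>
  define Inv where "Inv i R' \<longleftrightarrow> same {NBR, ADR, ENT, TMP, PTR, CONF} R R' \<and> R' ADR = v + i * n \<and>
     (1 \<le> v \<longrightarrow> (R' CONF = 0 \<longleftrightarrow>
        \<not> (\<exists>u\<in>{i<..n}. vertex u \<in> S \<and> (vertex u, vertex v) \<in> parcs G)))" for i R'
  have last: "wp inp (Basic [Add PTR CELLS VTX] ;; Unless CONF (Basic [Store PTR ONE])) (1 + (1 + 1)) P R'"
    if Inv: "Inv 0 R'" for R'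
  proof -
    have same: "same {NBR, ADR, ENT, TMP, PTR, CONF} R R'" using Inv by (simp add: Inv_def)
    have r: "R' CELLS = cb" "R' VTX = v" "R' ONE = 1"
      using R same by (auto simp: same_def vars_def)
    have c: "R' (cb + u) = of_bool (vertex u \<in> S)" if "u \<in> {1..n}" for u
      using R(2) same that by (simp add: same_def cells_def)
    have conf: "R' CONF = 0 \<longleftrightarrow> \<not> (\<exists>u\<in>S. (u, vertex v) \<in> parcs G)" if "1 \<le> v"
    proof -
      have "(\<exists>u\<in>S. (u, vertex v) \<in> parcs G) \<longleftrightarrow>
          (\<exists>u\<in>{0<..n}. vertex u \<in> S \<and> (vertex u, vertex v) \<in> parcs G)"
      proof -
        have "S \<subseteq> vertex ` {1..n}" using bij_vertex R(5) by (simp add: bij_betw_def)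
        then show ?thesis by force
      qed
      then show ?thesis using Inv that by (simp add: Inv_def)
    qed
    show ?thesis
    proof (rule wp_Seq, rule wp_Basic, simp, simp, rule wp_Unless)
      let ?R = "fold (update inp) [Add PTR CELLS VTX] R'"
      assume pos: "?R CONF > 0"
      have "process v S = S" if "1 \<le> v"
        using conf[OF that] pos by (auto simp: process_def greedy_insert_def)
      then have "process v S = S" by (cases "v = 0") (auto simp: process_def)
      then show "P ?R"
        using same c by (intro P) (auto simp: same_def cells_def)
    next
      let ?R = "fold (update inp) [Add PTR CELLS VTX] R'"
      assume zero: "?R CONF = 0"
      have proc: "process v S = insert (vertex v) S" if "1 \<le> v"
        using conf[OF that] zero that by (auto simp: process_def greedy_insert_def)
      have upd: "fold (update inp) [Store PTR ONE] ?R = R'(PTR := cb + v, cb + v := 1)"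
        using r by simp
      have "P (R'(PTR := cb + v, cb + v := 1))"
      proof (rule P)
        show "same ({NBR, ADR, ENT, TMP, PTR, CONF} \<union> {cb..cb + n}) R (R'(PTR := cb + v, cb + v := 1))"
          using same R(4) by (auto simp: same_def)
        show "cells (R'(PTR := cb + v, cb + v := 1)) (process v S)"
        proof (cases "v = 0")
          \<comment> \<open>Whatever is stored goes to the cell of index 0, outside the range of
            \<open>cells\<close>.\<close>
          case True
          then show ?thesis using c by (auto simp: cells_def process_def)
        next
          case False
          then show ?thesis
            using c proc R(4) vertex_eq_iff[of _ v] by (auto simp: cells_def)
        qed
      qed
      then show "wp inp (Basic [Store PTR ONE]) 1 P ?R"
        by (intro wp_Basic) (simp_all only: upd, simp_all)
    qed
  qed
  have loop: "wp inp (For NBR ORD (Basic [Sub ADR ADR ORD, Read ENT ADR, Add PTR CELLS NBR, Load TMP PTR, Add TMP TMP ENT,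
      Sub TMP TMP ONE, Add CONF CONF TMP])) (2 + n * (7 + 2))
      (wp inp (Basic [Add PTR CELLS VTX] ;; Unless CONF (Basic [Store PTR ONE])) (1 + (1 + 1)) P)
      (R(ADR := v + n * n, CONF := 0))"
  proof (rule wp_For[where Inv = Inv and n = n])
    show "(R(ADR := v + n * n, CONF := 0)) ORD = n" using R by (simp add: vars_def)
    show "Inv n ((R(ADR := v + n * n, CONF := 0))(NBR := n))"
      by (simp add: Inv_def same_def)
  next
    fix i R' assume i: "1 \<le> i" "i \<le> n" "Inv i R'" "R' NBR = i"
    have same: "same {NBR, ADR, ENT, TMP, PTR, CONF} R R'" and a: "R' ADR = v + i * n"
      using i by (simp_all add: Inv_def)
    have r: "R' CELLS = cb" "R' ONE = 1" "R' ORD = n"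
      using R same by (auto simp: same_def vars_def)
    have c: "R' (cb + i) = of_bool (vertex i \<in> S)"
      using R(2) same i by (simp add: same_def cells_def)
    have a': "v + i * n - n = v + (i - 1) * n" using i(1) by (cases i) auto
    have range: "{i - 1<..n} = insert i {i<..n}" using i(1,2) by auto
    define e where "e = inp (v + (i - 1) * n)"
    have e: "e = of_bool ((vertex i, vertex v) \<in> parcs G)" if "1 \<le> v"
      unfolding e_def using that R(4) i by (intro inp_arc) auto
    define x where "x = of_bool (vertex i \<in> S) + e - 1"
    have fin: "fold (update inp) [Sub ADR ADR ORD, Read ENT ADR, Add PTR CELLS NBR, Load TMP PTR, Add TMP TMP ENT,
        Sub TMP TMP ONE, Add CONF CONF TMP] R' =
        R'(ADR := v + (i - 1) * n, ENT := e, PTR := cb + i, TMP := x, CONF := R' CONF + x)"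
      by (rule ext) (use a r i(4) c in \<open>auto simp: a' e_def x_def\<close>)
    have conf: "R' CONF + x = 0 \<longleftrightarrow>
        \<not> (\<exists>u\<in>{i - 1<..n}. vertex u \<in> S \<and> (vertex u, vertex v) \<in> parcs G)" if "1 \<le> v"
      using i(3) that unfolding range Inv_def x_def e[OF that] by auto
    show "wp inp (Basic [Sub ADR ADR ORD, Read ENT ADR, Add PTR CELLS NBR, Load TMP PTR, Add TMP TMP ENT,
        Sub TMP TMP ONE, Add CONF CONF TMP]) 7
        (\<lambda>R'. R' NBR = i \<and> R' ONE = 1 \<and> Inv (i - 1) (R'(NBR := i - 1))) R'"
    proof (rule wp_Basic)
      show "(\<lambda>R'. R' NBR = i \<and> R' ONE = 1 \<and> Inv (i - 1) (R'(NBR := i - 1)))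
        (fold (update inp) [Sub ADR ADR ORD, Read ENT ADR, Add PTR CELLS NBR, Load TMP PTR, Add TMP TMP ENT,
        Sub TMP TMP ONE, Add CONF CONF TMP] R')"
        unfolding fin using same r i(4) conf by (simp add: Inv_def same_def)
    qed simp_all
  qed (use n_pos last in simp_all)
  show ?thesis
    unfolding insert_com_def insert_time_def
    by (rule wp_Basic_Seq[OF _ _ _ wp_Seq[OF loop]]) (use R in \<open>simp_all add: vars_def\<close>)
qed


lemma vars_same: "same Z R R' \<Longrightarrow> {2..6} \<inter> Z = {} \<Longrightarrow> vars R \<Longrightarrow> vars R'"
  by (auto simp: vars_def same_def disjoint_iff)

lemma process_subset: "v \<le> n \<Longrightarrow> S \<subseteq> pverts G \<Longrightarrow> process v S \<subseteq> pverts G"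
  using vertex_in by (auto simp: process_def greedy_insert_def)

lemma fold_process_subset:
  "\<forall>v\<in>set xs. v \<le> n \<Longrightarrow> S \<subseteq> pverts G \<Longrightarrow> fold process xs S \<subseteq> pverts G"
  by (induction xs arbitrary: S) (simp_all add: process_subset)

lemma wp_greedy:
  assumes R: "vars R" "cells R S" "S \<subseteq> pverts G" "\<forall>r\<in>{21..<cb}. R r \<le> n"
    and P: "\<And>R'. \<lbrakk>same ({8..15} \<union> {cb..cb + n}) R R'; cells R' (fold process (map R [21..<cb]) S)\<rbrakk>
      \<Longrightarrow> P R'"
  shows "wp inp greedy_com (greedy_time k n) P R"
proof -
  define Z where "Z = {8..15} \<union> {cb..cb + n}"
  \<comment> \<open>With \<open>i\<close> slots left, those below \<open>cb - i\<close> have been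
    processed. Their contents may be taken from the initial \<open>R\<close> because
    \<open>Z\<close> avoids the slots.\<close>
  define Inv where "Inv i R' \<longleftrightarrow> same Z R R' \<and>
      cells R' (fold process (map R [21..<cb - i]) S)" for i R'
  show ?thesis
    unfolding greedy_com_def greedy_time_def
  proof (rule wp_For[where Inv = Inv])
    show "R SLOTS = k + 2 * n" using R by (simp add: vars_def)
    show "Inv (k + 2 * n) (R(IDX := k + 2 * n))"
      using R(2) by (auto simp: Inv_def same_def cells_def Z_def)
  next
    fix i R' assume i: "1 \<le> i" "i \<le> k + 2 * n" "Inv i R'" "R' IDX = i"
    let ?S = "fold process (map R [21..<cb - i]) S"
    have same: "same Z R R'" using i(3) by (simp add: Inv_def)
    have vars: "vars R'" by (rule vars_same[OF same _ R(1)]) (auto simp: Z_def)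
    have slot: "R' (cb - i) = R (cb - i)" 
      by (rule sameD[OF same]) (use i(1,2) in \<open>auto simp: Z_def\<close>)
    have bound: "R (cb - i) \<le> n" using R(4) i(1,2) by auto
    have S: "?S \<subseteq> pverts G" using R(3,4) by (intro fold_process_subset) auto
    have "cb - (i - 1) = Suc (cb - i)" using i(1,2) by linarith
    then have "[21..<cb - (i - 1)] = [21..<cb - i] @ [cb - i]"
      using i(2) by (simp only: upt_Suc_append)
    then have ext: "fold process (map R [21..<cb - (i - 1)]) S = process (R (cb - i)) ?S"
      by simp
    have fin: "fold (update inp) [Sub VTX CELLS IDX, Load VTX VTX] R' = R'(VTX := R (cb - i))"
      using vars i(4) slot i(1,2) by (auto simp: vars_def)
    have body: "wp inp insert_com (insert_time n)
        (\<lambda>R'. R' IDX = i \<and> R' ONE = 1 \<and> Inv (i - 1) (R'(IDX := i - 1))) (R'(VTX := R (cb - i)))"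
    proof (rule wp_insert)
      show "vars (R'(VTX := R (cb - i)))" using vars by (simp add: vars_def)
      show "cells (R'(VTX := R (cb - i))) ?S" using i(3) by (simp add: Inv_def cells_def)
      show "(R'(VTX := R (cb - i))) VTX = R (cb - i)" by simp
    next
      fix R'' assume R'': "same ({NBR, ADR, ENT, TMP, PTR, CONF} \<union> {cb..cb + n}) (R'(VTX := R (cb - i))) R''"
        "cells R'' (process (R (cb - i)) ?S)"
      have "R'' IDX = i" using sameD[OF R''(1), of IDX] i(4) by simp
      moreover have "R'' ONE = 1" using sameD[OF R''(1), of ONE] vars by (simp add: vars_def)
      moreover have "same Z R (R''(IDX := i - 1))"
        using same R''(1) by (auto simp: same_def Z_def)
      moreover have "cells (R''(IDX := i - 1)) (process (R (cb - i)) ?S)"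
        using R''(2) by (simp add: cells_def)
      ultimately show "R'' IDX = i \<and> R'' ONE = 1 \<and> Inv (i - 1) (R''(IDX := i - 1))"
        unfolding Inv_def ext by blast
    qed (use bound S in auto)
    show "wp inp (Basic [Sub VTX CELLS IDX, Load VTX VTX] ;; insert_com) (2 + insert_time n)
        (\<lambda>R'. R' IDX = i \<and> R' ONE = 1 \<and> Inv (i - 1) (R'(IDX := i - 1))) R'"
      by (rule wp_Basic_Seq[OF _ _ fin body]) simp_all
  qed (use P k_pos in \<open>auto simp: Inv_def Z_def\<close>)
qed

lemma wp_count:
  assumes R: "vars R" "cells R S" "S \<subseteq> pverts G"
    and P: "\<And>R'. \<lbrakk>same ({ENT, TMP, PTR, CNT, SIZE} \<union> {cb..cb + n}) R R'; R' SIZE = card S; cells R' {}\<rbrakk> \<Longrightarrow> P R'"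
  shows "wp inp count_com (count_time n) P R"
proof -
  define Z where "Z = {ENT, TMP, PTR, CNT, SIZE} \<union> {cb..cb + n}"
  \<comment> \<open>Cells above \<open>i\<close> have been cleared and are accounted for in
    \<open>SIZE\<close>; the others are intact.\<close>
  define Inv where "Inv i R' \<longleftrightarrow> same Z R R' \<and> R' ENT = 0 \<and>
      R' SIZE = card {u \<in> {i<..n}. vertex u \<in> S} \<and>
      (\<forall>u\<in>{1..n}. R' (cb + u) = of_bool (u \<le> i \<and> vertex u \<in> S))" for i R'
  have loop: "wp inp (For CNT ORD (Basic [Add PTR CELLS CNT, Load TMP PTR, Add SIZE SIZE TMP, Store PTR ENT]))
      (2 + n * (4 + 2)) P (R(SIZE := 0, ENT := 0))"
  proof (rule wp_For[where Inv = Inv and n = n])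
    show "(R(SIZE := 0, ENT := 0)) ORD = n" using R by (simp add: vars_def)
    show "Inv n ((R(SIZE := 0, ENT := 0))(CNT := n))"
      using R(2) by (auto simp: Inv_def same_def cells_def Z_def)
  next
    fix i R' assume i: "1 \<le> i" "i \<le> n" "Inv i R'" "R' CNT = i"
    have same: "same Z R R'" using i(3) by (simp add: Inv_def)
    have vars: "vars R'" by (rule vars_same[OF same _ R(1)]) (auto simp: Z_def)
    have fin: "fold (update inp) [Add PTR CELLS CNT, Load TMP PTR, Add SIZE SIZE TMP, Store PTR ENT] R' =
        R'(PTR := cb + i, TMP := of_bool (vertex i \<in> S), SIZE := R' SIZE + of_bool (vertex i \<in> S),
           cb + i := 0)"
      by (rule ext) (use vars i in \<open>auto simp: vars_def Inv_def\<close>)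
    have "{i - 1<..n} = insert i {i<..n}" using i(1,2) by auto
    then have "{u \<in> {i - 1<..n}. vertex u \<in> S} =
        (if vertex i \<in> S then insert i else id) {u \<in> {i<..n}. vertex u \<in> S}"
      by auto
    then have card: "card {u \<in> {i - 1<..n}. vertex u \<in> S} =
        card {u \<in> {i<..n}. vertex u \<in> S} + of_bool (vertex i \<in> S)"
      by simp
    show "wp inp (Basic [Add PTR CELLS CNT, Load TMP PTR, Add SIZE SIZE TMP, Store PTR ENT]) 4
        (\<lambda>R'. R' CNT = i \<and> R' ONE = 1 \<and> Inv (i - 1) (R'(CNT := i - 1))) R'"
    proof (rule wp_Basic)
      have "Inv (i - 1) ((R'(PTR := cb + i, TMP := of_bool (vertex i \<in> S),
          SIZE := R' SIZE + of_bool (vertex i \<in> S), cb + i := 0))(CNT := i - 1))"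
        unfolding Inv_def card using same i by (auto simp: same_def Z_def Inv_def)
      then show "(\<lambda>R'. R' CNT = i \<and> R' ONE = 1 \<and> Inv (i - 1) (R'(CNT := i - 1)))
        (fold (update inp) [Add PTR CELLS CNT, Load TMP PTR, Add SIZE SIZE TMP, Store PTR ENT] R')"
        unfolding fin using vars i(4) by (simp add: vars_def)
    qed simp_all
  next
    fix R' assume "Inv 0 R'"
    moreover have "{u \<in> {0<..n}. vertex u \<in> S} = {u \<in> {1..n}. vertex u \<in> S}" by auto
    ultimately show "P R'"
      using card_vertex[OF R(3)] by (intro P) (auto simp: Inv_def Z_def cells_def)
  qed (use n_pos in simp_all)
  show ?thesis
    unfolding count_com_def count_time_def
    by (rule wp_Basic_Seq[OF _ _ _ loop]) simp_all
qed

section \<open>Testing all tuples against the first greedy set\<close>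

definition M :: "'a set" where "M = greedy G vs {}"

text \<open>\<open>M\<close> in the order of \<open>vs\<close>, which is the order of its nonzero
  slots.\<close>

definition ms :: "'a list" where "ms = filter (\<lambda>v. v \<in> M) vs"

lemma M_subset: "M \<subseteq> pverts G"
  using greedy_subset[of G vs "{}"] set_vs by (simp add: M_def)

lemma set_ms: "set ms = M"
  using M_subset set_vs by (auto simp: ms_def)

definition good :: "nat list \<Rightarrow> bool" where
  "good ts \<longleftrightarrow> card (greedy G (map vertex ts @ ms @ vs) {}) = card M"

text \<open>What every test needs and restores. The tuple and \<open>BAD\<close> are absent because
  the nested loops change them.\<close>

definition ready :: "(nat \<Rightarrow> nat) \<Rightarrow> bool" where
  "ready R \<longleftrightarrow> vars R \<and> cells R {} \<and> R SIZE0 = card M \<and> (\<forall>r\<in>{21 + k..<cb}. R r \<le> n) \<and>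
     map vertex (filter (\<lambda>v. v \<noteq> 0) (map R [21 + k..<cb])) = ms @ vs"

text \<open>Apart from the cells, \<open>ready\<close> depends only on registers 2 to 7 and on the
  slots behind the tuple, all of which \<open>Z\<close> avoids.\<close>

lemma ready_same:
  assumes "same Z R R'" "Z \<subseteq> {8..<21 + k} \<union> {cb..}" "cells R' {}" "ready R"
  shows "ready R'"
proof -
  have "R' r = R r" if "r \<in> {21 + k..<cb} \<union> {2..7}" for r
    using that by (intro sameD[OF assms(1)]) (use assms(2) in auto)
  moreover from this have slots: "map R' [21 + k..<cb] = map R [21 + k..<cb]" by simp
  ultimately show ?thesis using assms(3,4) unfolding ready_def vars_def slots by simp
qed

lemma ready_upd: "r \<in> {21..<21 + k} \<Longrightarrow> ready R \<Longrightarrow> ready (R(r := x))"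
  by (rule ready_same[of "{r}" R]) (auto simp: same_def ready_def cells_def)

lemma wp_check:
  assumes R: "ready R" "\<forall>j\<in>{0..<k}. R (21 + j) \<in> {1..n}"
    and P: "\<And>R'. \<lbrakk>same ({8..17} \<union> {BAD} \<union> {cb..cb + n}) R R'; ready R';
      R' BAD = 0 \<longleftrightarrow> R BAD = 0 \<and> good (map R [21..<21 + k])\<rbrakk> \<Longrightarrow> P R'"
  shows "wp inp check_com (greedy_time k n + (count_time n + 4)) P R"
  unfolding check_com_def
proof (rule wp_Seq, rule wp_greedy)
  show "vars R" "cells R {}" using R(1) by (simp_all add: ready_def)
  have slot: "R r \<in> {1..n}" if "r \<in> {21..<21 + k}" for r
    using R(2)[rule_format, of "r - 21"] that by auto
  show "\<forall>r\<in>{21..<cb}. R r \<le> n"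
  proof
    fix r assume "r \<in> {21..<cb}"
    then show "R r \<le> n"
      using slot[of r] R(1) by (cases "r < 21 + k") (auto simp: ready_def)
  qed
  let ?C = "fold process (map R [21..<cb]) {}"
  have "[21..<cb] = [21..<21 + k] @ [21 + k..<cb]"
    by (rule upt_add_eq_append[of 21 "21 + k" "2 * n", simplified])
  \<comment> \<open>Loop counters are at least 1 inside the loops, so dropping zeros leaves the
    tuple intact.\<close>
  moreover have "filter (\<lambda>v. v \<noteq> 0) (map R [21..<21 + k]) = map R [21..<21 + k]"
    using slot by (force intro: filter_True)
  ultimately have C: "?C = greedy G (map vertex (map R [21..<21 + k]) @ ms @ vs) {}"
    using R(1) unfolding fold_process ready_def by simp
  have sub: "?C \<subseteq> pverts G"
    using \<open>\<forall>r\<in>{21..<cb}. R r \<le> n\<close> by (intro fold_process_subset) auto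
  fix R1 assume R1: "same ({8..15} \<union> {cb..cb + n}) R R1" "cells R1 ?C"
  show "wp inp (count_com ;; Basic [Sub TMP SIZE SIZE0, Add BAD BAD TMP, Sub TMP SIZE0 SIZE, Add BAD BAD TMP])
      (count_time n + 4) P R1"
  proof (rule wp_Seq, rule wp_count)
    show "vars R1" by (rule vars_same[OF R1(1) _ \<open>vars R\<close>]) auto
    show "cells R1 ?C" by (rule R1(2))
    show "?C \<subseteq> pverts G" by (rule sub)
  next
    fix R2 assume R2: "same ({ENT, TMP, PTR, CNT, SIZE} \<union> {cb..cb + n}) R1 R2"
      "R2 SIZE = card ?C" "cells R2 {}"
    let ?b = "R BAD + (card ?C - card M) + (card M - card ?C)"
    have same: "same ({8..17} \<union> {BAD} \<union> {cb..cb + n}) R R2"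
      using R1(1) R2(1) by (auto simp: same_def)
    have "R2 BAD = R BAD" "R2 SIZE0 = card M"
      using R1(1) R2(1) R(1) by (auto simp: same_def ready_def)
    then have fin: "fold (update inp) [Sub TMP SIZE SIZE0, Add BAD BAD TMP, Sub TMP SIZE0 SIZE, Add BAD BAD TMP] R2 =
        R2(TMP := card M - card ?C, BAD := ?b)"
      by (intro ext) (auto simp: R2(2))
    have "P (R2(TMP := card M - card ?C, BAD := ?b))"
    proof (rule P)
      show same': "same ({8..17} \<union> {BAD} \<union> {cb..cb + n}) R (R2(TMP := card M - card ?C, BAD := ?b))"
        using same by (auto simp: same_def)
      show "ready (R2(TMP := card M - card ?C, BAD := ?b))"
        by (rule ready_same[OF same' _ _ R(1)]) (use R2(3) in \<open>auto simp: cells_def\<close>)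
      show "(R2(TMP := card M - card ?C, BAD := ?b)) BAD = 0 \<longleftrightarrow>
          R BAD = 0 \<and> good (map R [21..<21 + k])"
        unfolding good_def C[symmetric] by auto
    qed
    then show "wp inp (Basic [Sub TMP SIZE SIZE0, Add BAD BAD TMP, Sub TMP SIZE0 SIZE, Add BAD BAD TMP]) 4 P R2"
      by (intro wp_Basic) (simp_all only: fin, simp_all)
  qed
qed simp

text \<open>Induction on the depth: the outer loops have fixed the slots from \<open>j\<close> on,
  and the inner loops range over all beginnings \<open>ts\<close> of length
  \<open>j\<close>.\<close>

lemma wp_nest:
  assumes "j \<le> k" "ready R" "\<forall>i\<in>{j..<k}. R (21 + i) \<in> {1..n}"
    "\<And>R'. \<lbrakk>ready R'; \<forall>i\<in>{j..<k}. R' (21 + i) = R (21 + i);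
      R' BAD = 0 \<longleftrightarrow> R BAD = 0 \<and>
        (\<forall>ts. set ts \<subseteq> {1..n} \<longrightarrow> length ts = j \<longrightarrow> good (ts @ map R [21 + j..<21 + k]))\<rbrakk>
      \<Longrightarrow> P R'"
  shows "wp inp (nest_com j) (nest_time k n j) P R"
  using assms
proof (induction j arbitrary: R P)
  case 0
  show ?case
    unfolding nest_com.simps nest_time.simps
  proof (rule wp_check)
    fix R' assume R': "same ({8..17} \<union> {BAD} \<union> {cb..cb + n}) R R'" "ready R'"
      "R' BAD = 0 \<longleftrightarrow> R BAD = 0 \<and> good (map R [21..<21 + k])"
    show "P R'" by (rule 0(4)) (use R' in \<open>auto simp: same_def\<close>)
  qed (use 0 in simp_all)
next
  case (Suc j)
  define rest where "rest = map R [21 + Suc j..<21 + k]"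
  \<comment> \<open>The values of counter \<open>j\<close> above \<open>i\<close> have been tried;
    such a value \<open>x\<close> stands just before the slots of the outer loops.\<close>
  define Inv where "Inv i R' \<longleftrightarrow> ready R' \<and> (\<forall>i\<in>{Suc j..<k}. R' (21 + i) = R (21 + i)) \<and>
      (R' BAD = 0 \<longleftrightarrow> R BAD = 0 \<and> (\<forall>x\<in>{i<..n}. \<forall>ts. set ts \<subseteq> {1..n} \<longrightarrow> length ts = j \<longrightarrow>
         good (ts @ x # rest)))" for i R'
  show ?case
    unfolding nest_com.simps nest_time.simps
  proof (rule wp_For[where Inv = Inv and n = n])
    show "R ORD = n" using Suc.prems by (simp add: ready_def vars_def)
    show "Inv n (R(BASE + j := n))"
      using Suc.prems(1,2) by (auto simp: Inv_def intro: ready_upd)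
  next
    fix i R' assume i: "1 \<le> i" "i \<le> n" "Inv i R'" "R' (BASE + j) = i"
    have range: "{i - 1<..n} = insert i {i<..n}" using i(1,2) by auto
    have "[21 + j..<21 + k] = (21 + j) # [21 + Suc j..<21 + k]"
      using Suc.prems(1) by (simp add: upt_conv_Cons)
    moreover have "map R' [21 + Suc j..<21 + k] = rest"
    proof -
      have "R' r = R r" if "r \<in> {21 + Suc j..<21 + k}" for r
      proof -
        have "r - 21 \<in> {Suc j..<k}" "21 + (r - 21) = r" using that by auto
        then show ?thesis using i(3) unfolding Inv_def by metis
      qed
      then show ?thesis by (simp add: rest_def)
    qed
    ultimately have slots: "map R' [21 + j..<21 + k] = i # rest" using i(4) by simp
    show "wp inp (nest_com j) (nest_time k n j)
        (\<lambda>R'. R' (BASE + j) = i \<and> R' ONE = 1 \<and> Inv (i - 1) (R'(BASE + j := i - 1))) R'"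
    proof (rule Suc.IH)
      show "j \<le> k" "ready R'" using Suc.prems(1) i(3) by (auto simp: Inv_def)
      show "\<forall>i\<in>{j..<k}. R' (21 + i) \<in> {1..n}"
      proof
        fix m assume "m \<in> {j..<k}"
        then show "R' (21 + m) \<in> {1..n}"
          using i Suc.prems(3) by (cases "m = j") (auto simp: Inv_def)
      qed
    next
      fix R'' assume R'': "ready R''" "\<forall>i\<in>{j..<k}. R'' (21 + i) = R' (21 + i)"
        "R'' BAD = 0 \<longleftrightarrow> R' BAD = 0 \<and> (\<forall>ts. set ts \<subseteq> {1..n} \<longrightarrow> length ts = j \<longrightarrow>
           good (ts @ map R' [21 + j..<21 + k]))"
      have "R'' (BASE + j) = i" using R''(2) i(4) Suc.prems(1) by simp
      moreover have "R'' ONE = 1" using R''(1) by (simp add: ready_def vars_def)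
      moreover have "ready (R''(BASE + j := i - 1))"
        using R''(1) Suc.prems(1) by (intro ready_upd) auto
      moreover have "\<forall>m\<in>{Suc j..<k}. (R''(BASE + j := i - 1)) (21 + m) = R (21 + m)"
        using R''(2) i(3) by (auto simp: Inv_def)
      moreover have "(R''(BASE + j := i - 1)) BAD = 0 \<longleftrightarrow> R BAD = 0 \<and>
         (\<forall>x\<in>{i - 1<..n}. \<forall>ts. set ts \<subseteq> {1..n} \<longrightarrow> length ts = j \<longrightarrow> good (ts @ x # rest))"
        using R''(3) i(3) unfolding Inv_def range slots by auto
      ultimately show "R'' (BASE + j) = i \<and> R'' ONE = 1 \<and> Inv (i - 1) (R''(BASE + j := i - 1))"
        unfolding Inv_def by blast
    qed
  next
    fix R' assume Inv: "Inv 0 R'"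
    have split: "(\<forall>ts. set ts \<subseteq> {1..n} \<longrightarrow> length ts = Suc j \<longrightarrow> good (ts @ rest)) \<longleftrightarrow>
        (\<forall>x\<in>{0<..n}. \<forall>ts. set ts \<subseteq> {1..n} \<longrightarrow> length ts = j \<longrightarrow> good (ts @ x # rest))"
      (is "?L \<longleftrightarrow> ?R")
    proof
      assume L: ?L
      show ?R
      proof (intro ballI allI impI)
        fix x ts assume "x \<in> {0<..n}" "set ts \<subseteq> {1..n}" "length ts = j"
        then show "good (ts @ x # rest)"
          using L[rule_format, of "ts @ [x]"] by auto
      qed
    next
      assume R: ?R
      show ?L
      proof (intro allI impI)
        fix ts :: "nat list" assume ts: "set ts \<subseteq> {1..n}" "length ts = Suc j"
        then obtain us x where "ts = us @ [x]" by (metis append_butlast_last_id length_0_conv nat.distinct(1))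
        then show "good (ts @ rest)" using R ts by auto
      qed
    qed
    have "R' BAD = 0 \<longleftrightarrow> R BAD = 0 \<and>
        (\<forall>ts. set ts \<subseteq> {1..n} \<longrightarrow> length ts = Suc j \<longrightarrow> good (ts @ rest))"
      unfolding split using Inv by (simp only: Inv_def)
    then show "P R'"
      unfolding rest_def
      by (rule Suc.prems(4)[OF conjunct1[OF Inv[unfolded Inv_def]]
            conjunct1[OF conjunct2[OF Inv[unfolded Inv_def]]]])
  qed (use n_pos in simp_all)
qed


section \<open>Initialization and the complete program\<close>

lemma wp_sqrt:
  assumes R: "R ONE = 1" "R LEN = n * n"
    and P: "\<And>R'. \<lbrakk>same {ORD, ADR, ENT} R R'; R' ORD = n\<rbrakk> \<Longrightarrow> P R'"
  shows "wp inp sqrt_com (4 + n * (4 + 1)) P R"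
proof -
  \<comment> \<open>After \<open>n - i\<close> rounds the first \<open>n - i\<close> odd numbers,
    with sum the square of \<open>n - i\<close>, have been subtracted; \<open>ENT\<close> is the
    next one.\<close>
  define Inv where "Inv i R' \<longleftrightarrow> same {ORD, ADR, ENT} R R' \<and> R' ORD = n - i \<and>
      R' ADR = n * n - (n - i) * (n - i) \<and> R' ENT = 2 * (n - i) + 1" for i R'
  have loop: "wp inp (Repeat (Basic [Sub ADR ADR ENT, Add ORD ORD ONE, Add ENT ENT ONE, Add ENT ENT ONE]) ADR)
      (n * (4 + 1)) P (R(ORD := 0, ADR := n * n, ENT := 1))"
  proof (rule wp_Repeat[where Inv = Inv])
    show "Inv n (R(ORD := 0, ADR := n * n, ENT := 1))" by (simp add: Inv_def same_def)
  next
    fix i R' assume i: "i < n" "Inv (Suc i) R'"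
    define m where "m = n - Suc i"
    have m: "n - i = Suc m" "n - Suc i = m" "n = Suc m + i" using i(1) by (auto simp: m_def)
    have R': "R' ORD = m" "R' ADR = n * n - m * m" "R' ENT = 2 * m + 1" "R' ONE = 1"
      using i(2) R(1) unfolding Inv_def m by (auto simp: same_def)
    have a: "n * n - m * m - (2 * m + 1) = n * n - Suc m * Suc m" by simp
    \<comment> \<open>The remainder is positive as long as rounds are left, so the loop stops
      exactly when \<open>ORD\<close> has reached \<open>n\<close>.\<close>
    have "Suc m * Suc m < n * n" if "0 < i"
      by (rule mult_strict_mono) (use that m(3) in simp_all)
    then have pos: "0 < n * n - Suc m * Suc m \<longleftrightarrow> 0 < i"
      using m(3) by (cases "i = 0") simp_all
    have fin: "fold (update inp) [Sub ADR ADR ENT, Add ORD ORD ONE, Add ENT ENT ONE, Add ENT ENT ONE] R' =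
        R'(ADR := n * n - Suc m * Suc m, ORD := Suc m, ENT := 2 * Suc m + 1)"
      by (rule ext) (use R' a in auto)
    have "Inv i (R'(ADR := n * n - Suc m * Suc m, ORD := Suc m, ENT := 2 * Suc m + 1))"
      using i(2) unfolding Inv_def m by (auto simp: same_def)
    then show "wp inp (Basic [Sub ADR ADR ENT, Add ORD ORD ONE, Add ENT ENT ONE, Add ENT ENT ONE]) 4
        (\<lambda>R'. Inv i R' \<and> (R' ADR > 0 \<longleftrightarrow> i > 0)) R'"
      using pos by (intro wp_Basic) (simp_all only: fin, simp_all)
  qed (use n_pos P in \<open>auto simp: Inv_def\<close>)
  show ?thesis
    unfolding sqrt_com_def by (rule wp_Basic_Seq[OF _ _ _ loop]) (use R in \<open>auto\<close>)
qed

lemma wp_layout: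
  assumes R: "R ONE = 1" "R LEN = n * n" "R ORD = n" "\<forall>r\<ge>21. R r = 0"
    and P: "\<And>R'. \<lbrakk>same ({CELLS, SLOTS, PTR, CNT, MBASE, ABASE} \<union> {21..}) R R'; vars R'; R' MBASE = 20 + k;
      \<forall>r\<ge>21. R' r = (if r \<in> {20 + k + n<..20 + k + n + n} then r - (20 + k + n) else 0)\<rbrakk> \<Longrightarrow> P R'"
  shows "wp inp (layout_com k) (6 + (2 + n * (2 + 2))) P R"
proof -
  let ?ab = "20 + k + n"
  let ?R = "R(MBASE := 20 + k, ABASE := ?ab, CELLS := cb, SLOTS := k + 2 * n)"
  define Inv where "Inv i R' \<longleftrightarrow> same ({CELLS, SLOTS, PTR, CNT, MBASE, ABASE} \<union> {21..}) R R' \<and> vars R' \<and>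
      R' MBASE = 20 + k \<and> R' ABASE = ?ab \<and>
      (\<forall>r\<ge>21. R' r = (if r \<in> {?ab + i<..?ab + n} then r - ?ab else 0))" for i R'
  have loop: "wp inp (For CNT ORD (Basic [Add PTR ABASE CNT, Store PTR CNT])) (2 + n * (2 + 2)) P ?R"
  proof (rule wp_For[where Inv = Inv])
    show "?R ORD = n" using R by simp
    show "Inv n (?R(CNT := n))" using R by (auto simp: Inv_def same_def vars_def)
  next
    fix i R' assume i: "1 \<le> i" "i \<le> n" "Inv i R'" "R' CNT = i"
    have fin: "fold (update inp) [Add PTR ABASE CNT, Store PTR CNT] R' = R'(PTR := ?ab + i, ?ab + i := i)"
      using i(3,4) by (simp add: Inv_def)
    have range: "{?ab + (i - 1)<..?ab + n} = insert (?ab + i) {?ab + i<..?ab + n}"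
      using i(1,2) by auto
    have "Inv (i - 1) ((R'(PTR := ?ab + i, ?ab + i := i))(CNT := i - 1))"
      using i unfolding Inv_def range by (auto simp: same_def vars_def)
    then show "wp inp (Basic [Add PTR ABASE CNT, Store PTR CNT]) 2
        (\<lambda>R'. R' CNT = i \<and> R' ONE = 1 \<and> Inv (i - 1) (R'(CNT := i - 1))) R'"
      using i(1,3,4) by (intro wp_Basic) (simp_all only: fin, simp_all add: Inv_def vars_def)
  next
    fix R' assume "Inv 0 R'"
    then show "P R'" by (intro P) (auto simp: Inv_def)
  qed (use n_pos in simp_all)
  show ?thesis
    unfolding layout_com_def
    by (rule wp_Basic_Seq[OF _ _ _ loop]) (use R in \<open>auto\<close>)
qed

lemma wp_record:
  assumes R: "vars R" "cells R S" "R MBASE = 20 + k"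
    and P: "\<And>R'. \<lbrakk>same ({TMP, PTR, CNT} \<union> {20 + k<..20 + k + n}) R R';
      \<forall>j\<in>{1..n}. R' (20 + k + j) = (if vertex j \<in> S then j else R (20 + k + j))\<rbrakk> \<Longrightarrow> P R'"
  shows "wp inp record_com (2 + n * ((4 + (1 + 1)) + 2)) P R"
proof -
  let ?mb = "20 + k"
  define Inv where "Inv i R' \<longleftrightarrow> same ({TMP, PTR, CNT} \<union> {?mb<..?mb + n}) R R' \<and>
      (\<forall>j\<in>{1..n}. R' (?mb + j) = (if i < j \<and> vertex j \<in> S then j else R (?mb + j)))" for i R'
  show ?thesis
    unfolding record_com_def
  proof (rule wp_For[where Inv = Inv])
    show "R ORD = n" using R by (simp add: vars_def)
    show "Inv n (R(CNT := n))" by (auto simp: Inv_def same_def)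
  next
    fix i R' assume i: "1 \<le> i" "i \<le> n" "Inv i R'" "R' CNT = i"
    have same: "same ({TMP, PTR, CNT} \<union> {?mb<..?mb + n}) R R'" using i(3) by (simp add: Inv_def)
    have vars: "vars R'" by (rule vars_same[OF same _ R(1)]) auto
    have mb: "R' MBASE = ?mb" using sameD[OF same, of MBASE] R(3) by auto
    have c: "R' (cb + i) = of_bool (vertex i \<in> S)"
      using sameD[OF same, of "cb + i"] R(2) i(1,2) by (simp add: cells_def)
    let ?R = "R'(PTR := ?mb + i, TMP := 1 - of_bool (vertex i \<in> S))"
    have fin: "fold (update inp) [Add PTR CELLS CNT, Load TMP PTR, Sub TMP ONE TMP, Add PTR MBASE CNT] R' = ?R"
      by (rule ext) (use vars mb c i(4) in \<open>auto simp: vars_def\<close>)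
    let ?P = "\<lambda>R'. R' CNT = i \<and> R' ONE = 1 \<and> Inv (i - 1) (R'(CNT := i - 1))"
    have range: "i - 1 < j \<longleftrightarrow> j = i \<or> i < j" for j using i(1) by auto
    have "wp inp (Unless TMP (Basic [Store PTR CNT])) (1 + 1) ?P ?R"
    proof (rule wp_Unless)
      assume "?R TMP > 0"
      then have "vertex i \<notin> S" by simp
      then have "Inv (i - 1) (?R(CNT := i - 1))"
        using i same unfolding Inv_def range by (auto simp: same_def)
      then show "?P ?R" using i(4) vars by (simp add: vars_def)
    next
      assume "?R TMP = 0"
      then have S: "vertex i \<in> S" by (cases "vertex i \<in> S") auto
      have "Inv (i - 1) (?R(?mb + i := i, CNT := i - 1))"
        using i same S unfolding Inv_def range by (auto simp: same_def)
      moreover have "fold (update inp) [Store PTR CNT] ?R = ?R(?mb + i := i)" using i(4) by simp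
      ultimately show "wp inp (Basic [Store PTR CNT]) 1 ?P ?R"
        using i(1,4) vars by (intro wp_Basic) (simp_all add: vars_def)
    qed
    then show "wp inp (Basic [Add PTR CELLS CNT, Load TMP PTR, Sub TMP ONE TMP, Add PTR MBASE CNT] ;;
        Unless TMP (Basic [Store PTR CNT])) (4 + (1 + 1)) ?P R'"
      by (rule wp_Basic_Seq[OF _ _ fin, rotated 2]) simp_all
  next
    fix R' assume "Inv 0 R'"
    then show "P R'" by (intro P) (auto simp: Inv_def)
  qed (use n_pos in simp_all)
qed

definition all_good :: bool where
  "all_good \<longleftrightarrow> (\<forall>ts. set ts \<subseteq> {1..n} \<longrightarrow> length ts = k \<longrightarrow> good ts)"

lemma map_slots:
  assumes "\<forall>j\<in>{1..n}. R (m + j) = f j" "a = m + 1" "b = a + n"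
  shows "map R [a..<b] = map f [1..<n + 1]"
proof (rule nth_equalityI)
  fix i assume "i < length (map R [a..<b])"
  then have i: "i < n" using assms(3) by simp
  then have "R (m + Suc i) = f (Suc i)" using assms(1) by (intro bspec[OF assms(1)]) simp
  then show "map R [a..<b] ! i = map f [1..<n + 1] ! i"
    using i assms(2,3) by (simp add: nth_map nth_upt del: upt_Suc)
qed (simp add: assms(3) del: upt_Suc)

lemma slots_split: "[21..<cb] = [21..<21 + k + n] @ [21 + k + n..<cb]"
    "[21 + k..<cb] = [21 + k..<21 + k + n] @ [21 + k + n..<cb]"
proof -
  have cb: "cb = 21 + k + n + n" by simp
  show "[21..<cb] = [21..<21 + k + n] @ [21 + k + n..<cb]"
    unfolding cb by (rule upt_add_eq_append) simp
  show "[21 + k..<cb] = [21 + k..<21 + k + n] @ [21 + k + n..<cb]"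
    unfolding cb by (rule upt_add_eq_append) simp
qed

text \<open>The block for \<open>M\<close> holds at place \<open>j\<close> either \<open>j\<close>
  or 0. Dropping the zeros gives \<open>ms\<close>, and the full block behind it gives
  \<open>vs\<close>; this establishes \<open>ready\<close>.\<close>

lemma wp_nest_start:
  assumes R: "vars R" "cells R {}" "R SIZE0 = card M" "R BAD = 0"
    and slots: "\<forall>j\<in>{1..n}. R (20 + k + j) = (if vertex j \<in> M then j else 0)"
      "\<forall>j\<in>{1..n}. R (20 + k + n + j) = j"
    and P: "\<And>R'. \<lbrakk>vars R'; R' BAD = 0 \<longleftrightarrow> all_good\<rbrakk> \<Longrightarrow> P R'"
  shows "wp inp (nest_com k) (nest_time k n k) P R"
proof -
  have "map R [21 + k..<21 + k + n] = map (\<lambda>j. if vertex j \<in> M then j else 0) [1..<n + 1]"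
    by (rule map_slots[OF slots(1)]) simp_all
  moreover have "map R [21 + k + n..<cb] = map (\<lambda>j. j) [1..<n + 1]"
    by (rule map_slots[OF slots(2)]) simp_all
  ultimately have list: "map R [21 + k..<cb] =
      map (\<lambda>j. if vertex j \<in> M then j else 0) [1..<n + 1] @ [1..<n + 1]"
    by (simp only: slots_split map_append map_ident)
  have "ready R"
    unfolding ready_def
  proof (intro conjI ballI)
    fix r assume "r \<in> {21 + k..<cb}"
    then have "R r \<in> set (map R [21 + k..<cb])" by simp
    then show "R r \<le> n" unfolding list by (auto split: if_splits)
  next
    have nz: "filter (\<lambda>v. v \<noteq> 0) [1..<n + 1] = [1..<n + 1]" by (rule filter_True) auto
    have "0 \<notin> set [1..<n + 1]" by (simp del: upt_Suc)
    then have filter: "filter (\<lambda>v. v \<noteq> 0) (map (\<lambda>j. if vertex j \<in> M then j else 0) [1..<n + 1]) =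
        filter (\<lambda>j. vertex j \<in> M) [1..<n + 1]"
      by (rule filter_nonzero_map)
    have "map vertex (filter (\<lambda>j. vertex j \<in> M) [1..<n + 1]) =
        filter (\<lambda>v. v \<in> M) (map vertex [1..<n + 1])"
      by (simp only: filter_map comp_def)
    then show "map vertex (filter (\<lambda>v. v \<noteq> 0) (map R [21 + k..<cb])) = ms @ vs"
      by (simp only: list filter filter_append map_append nz map_vertex ms_def)
  qed (use R in auto)
  then show ?thesis
    using R(4) by (intro wp_nest P) (auto simp: all_good_def ready_def)
qed

lemma wp_main:
  assumes P: "\<And>R'. \<lbrakk>vars R'; R' BAD = 0 \<longleftrightarrow> all_good\<rbrakk> \<Longrightarrow> P R'"
  shows "wp inp (main_com k) (main_time k n) P ((\<lambda>_. 0)(ONE := 1, LEN := n * n))"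
  unfolding main_com_def main_time_def
proof (rule wp_Seq, rule wp_sqrt)
  fix R1 assume R1: "same {ORD, ADR, ENT} ((\<lambda>_. 0)(ONE := 1, LEN := n * n)) R1" "R1 ORD = n"
  show "wp inp (layout_com k ;; greedy_com ;; record_com ;; count_com ;;
     Basic [Const SIZE0 0, Add SIZE0 SIZE0 SIZE] ;; nest_com k) ((6 + (2 + n * (2 + 2))) + (greedy_time k n +
       ((2 + n * ((4 + (1 + 1)) + 2)) + (count_time n + (2 + nest_time k n k))))) P R1"
  proof (rule wp_Seq, rule wp_layout)
    show "R1 ONE = 1" "R1 LEN = n * n" "R1 ORD = n" "\<forall>r\<ge>21. R1 r = 0"
      using R1 by (auto simp: same_def)
    fix R2 assume R2: "same ({CELLS, SLOTS, PTR, CNT, MBASE, ABASE} \<union> {21..}) R1 R2" "vars R2" "R2 MBASE = 20 + k"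
      "\<forall>r\<ge>21. R2 r = (if r \<in> {20 + k + n<..20 + k + n + n} then r - (20 + k + n) else 0)"
    have bad2: "R2 BAD = 0" using R1(1) R2(1) by (auto simp: same_def)
    \<comment> \<open>All slots below the vertex block hold 0, so the first greedy run processes
      just \<open>vs\<close> and yields \<open>M\<close>.\<close>
    have "map R2 [21..<21 + k + n] = map (\<lambda>_. 0) [21..<21 + k + n]" using R2(4) by auto
    then have zeros: "filter (\<lambda>v. v \<noteq> 0) (map R2 [21..<21 + k + n]) = []" by simp
    have "map R2 [21 + k + n..<cb] = map (\<lambda>j. j) [1..<n + 1]"
      by (rule map_slots[of _ "20 + k + n"]) (use R2(4) in auto)
    moreover have "filter (\<lambda>v. v \<noteq> 0) [1..<n + 1] = [1..<n + 1]" by (rule filter_True) auto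
    ultimately have M: "fold process (map R2 [21..<cb]) {} = M"
      using zeros unfolding fold_process M_def
      by (simp only: slots_split map_append filter_append append_Nil map_ident map_vertex)
    show "wp inp (greedy_com ;; record_com ;; count_com ;;
       Basic [Const SIZE0 0, Add SIZE0 SIZE0 SIZE] ;; nest_com k) (greedy_time k n +
       ((2 + n * ((4 + (1 + 1)) + 2)) + (count_time n + (2 + nest_time k n k)))) P R2"
    proof (rule wp_Seq, rule wp_greedy)
      show "vars R2" by fact
      show "cells R2 {}" using R2(4) by (auto simp: cells_def)
      show "\<forall>r\<in>{21..<cb}. R2 r \<le> n" using R2(4) by auto
      fix R3 assume "same ({8..15} \<union> {cb..cb + n}) R2 R3"
        "cells R3 (fold process (map R2 [21..<cb]) {})"
      then have R3: "same ({8..15} \<union> {cb..cb + n}) R2 R3" "cells R3 M" unfolding M by auto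
      have vars3: "vars R3" by (rule vars_same[OF R3(1) _ R2(2)]) auto
      show "wp inp (record_com ;; count_com ;; Basic [Const SIZE0 0, Add SIZE0 SIZE0 SIZE] ;; nest_com k)
        ((2 + n * ((4 + (1 + 1)) + 2)) + (count_time n + (2 + nest_time k n k))) P R3"
      proof (rule wp_Seq, rule wp_record)
        show "vars R3" "cells R3 M" by fact+
        show "R3 MBASE = 20 + k" using R3(1) R2(3) by (auto simp: same_def)
        fix R4 assume R4: "same ({TMP, PTR, CNT} \<union> {20 + k<..20 + k + n}) R3 R4"
          "\<forall>j\<in>{1..n}. R4 (20 + k + j) = (if vertex j \<in> M then j else R3 (20 + k + j))"
        have vars4: "vars R4" by (rule vars_same[OF R4(1) _ vars3]) auto
        show "wp inp (count_com ;; Basic [Const SIZE0 0, Add SIZE0 SIZE0 SIZE] ;; nest_com k)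
          (count_time n + (2 + nest_time k n k)) P R4"
        proof (rule wp_Seq, rule wp_count)
          show "vars R4" by fact
          show "cells R4 M" using R3(2) R4(1) by (auto simp: cells_def same_def)
          show "M \<subseteq> pverts G" by (rule M_subset)
          fix R5 assume R5: "same ({ENT, TMP, PTR, CNT, SIZE} \<union> {cb..cb + n}) R4 R5" "R5 SIZE = card M"
            "cells R5 {}"
          have vars5: "vars R5" by (rule vars_same[OF R5(1) _ vars4]) auto
          have slot: "R5 r = R4 r" if "r \<in> {20..<cb}" for r
            by (rule sameD[OF R5(1)]) (use that in auto)
          have slot3: "R3 r = R2 r" if "r \<in> {20..<cb}" for r
            by (rule sameD[OF R3(1)]) (use that in auto)
          have slot4: "R4 r = R3 r" if "r = 20 \<or> r \<in> {21 + k + n..<cb}" for r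
            by (rule sameD[OF R4(1)]) (use that in auto)
          have "wp inp (nest_com k) (nest_time k n k) P (R5(SIZE0 := card M))"
          proof (rule wp_nest_start)
            show "vars (R5(SIZE0 := card M))" using vars5 by (simp add: vars_def)
            show "cells (R5(SIZE0 := card M)) {}" using R5(3) by (simp add: cells_def)
            show "(R5(SIZE0 := card M)) BAD = 0" using bad2 slot slot3 slot4 by simp
            show "\<forall>j\<in>{1..n}. (R5(SIZE0 := card M)) (20 + k + j) = (if vertex j \<in> M then j else 0)"
            proof
              fix j assume j: "j \<in> {1..n}"
              have "R2 (20 + k + j) = 0" using R2(4) j by auto
              then show "(R5(SIZE0 := card M)) (20 + k + j) = (if vertex j \<in> M then j else 0)"
                using j R4(2) slot[of "20 + k + j"] slot3[of "20 + k + j"] by auto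
            qed
            show "\<forall>j\<in>{1..n}. (R5(SIZE0 := card M)) (20 + k + n + j) = j"
            proof
              fix j assume j: "j \<in> {1..n}"
              have "R2 (20 + k + n + j) = j" using R2(4) j by auto
              then show "(R5(SIZE0 := card M)) (20 + k + n + j) = j"
                using j slot[of "20 + k + n + j"] slot3[of "20 + k + n + j"]
                  slot4[of "20 + k + n + j"] by auto
            qed
          qed (use P in auto)
          then show "wp inp (Basic [Const SIZE0 0, Add SIZE0 SIZE0 SIZE] ;; nest_com k)
              (2 + nest_time k n k) P R5"
            by (rule wp_Basic_Seq[rotated 3]) (use R5(2) in auto)
        qed
      qed
    qed simp
  qed
qed simp_all

text \<open>Since \<open>vertex\<close> is a bijection from \<open>{1..n}\<close> to the vertices,
  tuples of numbers and tuples of vertices correspond.\<close>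

lemma all_good_iff:
  "all_good \<longleftrightarrow> (\<forall>ts. set ts \<subseteq> pverts G \<longrightarrow> length ts = k \<longrightarrow>
     card (greedy G (ts @ ms @ vs) {}) = card (set ms))"
proof
  assume L: all_good
  show "\<forall>ts. set ts \<subseteq> pverts G \<longrightarrow> length ts = k \<longrightarrow>
     card (greedy G (ts @ ms @ vs) {}) = card (set ms)"
  proof (intro allI impI)
    fix ts assume ts: "set ts \<subseteq> pverts G" "length ts = k"
    have img: "set ts \<subseteq> vertex ` {1..n}" using ts(1) bij_vertex by (simp add: bij_betw_def)
    let ?us = "map (inv_into {1..n} vertex) ts"
    have "map vertex ?us = map (\<lambda>x. x) ts"
      unfolding map_map comp_def using img by (intro map_cong refl f_inv_into_f) auto
    moreover have "set ?us \<subseteq> {1..n}" using img inv_into_into[of _ vertex "{1..n}"] by force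
    ultimately show "card (greedy G (ts @ ms @ vs) {}) = card (set ms)"
      using L ts(2) unfolding all_good_def good_def set_ms
      by (metis length_map map_ident)
  qed
next
  assume R: "\<forall>ts. set ts \<subseteq> pverts G \<longrightarrow> length ts = k \<longrightarrow>
     card (greedy G (ts @ ms @ vs) {}) = card (set ms)"
  show all_good
    unfolding all_good_def good_def
  proof (intro allI impI)
    fix ts assume ts: "set ts \<subseteq> {1..n}" "length ts = k"
    have "set (map vertex ts) \<subseteq> pverts G" using ts(1) vertex_in by auto
    then show "card (greedy G (map vertex ts @ ms @ vs) {}) = card M"
      using R ts(2) set_ms by simp
  qed
qed

lemma all_good_iff_well_covered:
  assumes "kl_partition 1 l G P" "2 * l + 1 \<le> k"
  shows "all_good \<longleftrightarrow> well_covered G"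
proof -
  have "maximal_independent_set G (set ms)"
    unfolding set_ms M_def
    by (rule maximal_greedy[OF G set_vs]) (simp add: independent_set_def)
  then show ?thesis
    using well_covered_iff_greedy[OF G assms(1) set_vs _ assms(2)] all_good_iff by blast
qed

lemma wp_decide:
  "wp inp (decide_com k) (decide_time k n) (\<lambda>R. R 0 \<noteq> 0 \<longleftrightarrow> all_good) (\<lambda>_. 0)"
proof -
  let ?P = "\<lambda>R. R 0 \<noteq> 0 \<longleftrightarrow> all_good"
  let ?R = "(\<lambda>_. 0)(ONE := 1, LEN := n * n)"
  have main: "wp inp (Unless IDX (main_com k) ;; Basic [Sub 0 ONE BAD]) ((main_time k n + 1) + 1) ?P ?R"
  proof (rule wp_Seq, rule wp_Unless)
    show "wp inp (main_com k) (main_time k n) (wp inp (Basic [Sub 0 ONE BAD]) 1 ?P) ?R"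
      by (rule wp_main, rule wp_Basic) (auto simp: vars_def)
  qed simp
  have "fold (update inp) [Const ONE 1, Read LEN 0, Sub IDX ONE LEN] (\<lambda>_. 0) = ?R"
    by (rule ext) (use n_pos inp_0 in \<open>auto simp: Suc_le_eq\<close>)
  from this main show ?thesis
    unfolding decide_com_def decide_time_def by (rule wp_Basic_Seq[rotated 2]) simp_all
qed

end

section \<open>Polynomial running time\<close>

text \<open>Equality is attainable instead of an upper bound, because the time functions arise from
  \<open>n\<close> and constants by sums and products.\<close>

definition polynomially_bounded :: "(nat \<Rightarrow> nat) \<Rightarrow> bool" where
  "polynomially_bounded f \<longleftrightarrow> (\<exists>p :: nat poly. \<forall>n. f n = poly p n)"

lemma polynomially_bounded_intros:
  "polynomially_bounded (\<lambda>n. n)"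
  "polynomially_bounded (\<lambda>_. c)"
  "polynomially_bounded f \<Longrightarrow> polynomially_bounded g \<Longrightarrow> polynomially_bounded (\<lambda>n. f n + g n)"
  "polynomially_bounded f \<Longrightarrow> polynomially_bounded g \<Longrightarrow> polynomially_bounded (\<lambda>n. f n * g n)"
proof -
  have "n = poly [:0, 1:] n" "c = poly [:c:] n" for n :: nat by simp_all
  then show "polynomially_bounded (\<lambda>n. n)" "polynomially_bounded (\<lambda>_. c)"
    unfolding polynomially_bounded_def by blast+
  show "polynomially_bounded (\<lambda>n. f n + g n)" "polynomially_bounded (\<lambda>n. f n * g n)"
    if "polynomially_bounded f" "polynomially_bounded g"
    using that unfolding polynomially_bounded_def by (metis poly_add poly_mult)+
qed

text \<open>Each level of nesting contributes one factor \<open>n\<close>. The number of levels is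
  the constant \<open>k\<close>, so the degree does not depend on the input.\<close>

lemma polynomially_bounded_decide_time: "polynomially_bounded (decide_time k)"
proof -
  note intros = polynomially_bounded_intros
  have greedy: "polynomially_bounded (greedy_time k)"
    unfolding greedy_time_def insert_time_def by (intro intros)
  have count: "polynomially_bounded count_time"
    unfolding count_time_def by (intro intros)
  have nest: "polynomially_bounded (\<lambda>n. nest_time k n j)" for j
    by (induction j) (simp_all only: nest_time.simps, (intro intros greedy count; assumption?)+)
  show ?thesis
    unfolding decide_time_def main_time_def by (intro intros greedy count nest)
qed

text \<open>Coefficients are natural numbers. This turns the bound in the number of vertices into
  one in the length of the word.\<close>

lemma poly_nat_mono: "x \<le> y \<Longrightarrow> poly p x \<le> poly p (y :: nat)"
  by (induction p) (auto intro: add_mono mult_mono)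

section \<open>The empty graph and the final assembly\<close>

text \<open>Length 0 sets \<open>IDX\<close> to 1, so the main program is skipped with
  \<open>BAD\<close> still 0, and the output is 1.\<close>

lemma wp_decide_empty:
  assumes "inp 0 = 0"
  shows "wp inp (decide_com k) (decide_time k 0) (\<lambda>R. R 0 \<noteq> 0) (\<lambda>_. 0)"
  unfolding decide_com_def decide_time_def
  by (rule wp_Basic_Seq[OF _ _ refl], simp, simp, rule wp_Seq, rule wp_Unless)
    (use assms in \<open>auto intro!: wp_Basic\<close>)

lemma well_covered_empty:
  assumes "pverts G = {}"
  shows "well_covered G"
  using assms by (auto simp: well_covered_def maximal_independent_set_def independent_set_def)

lemma decide_correct:
  assumes "kl_graph 1 l G" "distinct vs" "set vs = pverts G" "k = 2 * l + 1" "decide_time k (length vs) \<le> T"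
  defines "w \<equiv> adjacency_word G vs"
  shows "halted (code 0 (decide_com k)) (run (code 0 (decide_com k)) w T) \<and>
    (snd (run (code 0 (decide_com k)) w T) 0 \<noteq> 0 \<longleftrightarrow> well_covered G)"
proof -
  obtain P where G: "pair_graph G" and P: "kl_partition 1 l G P"
    using assms(1) by (auto simp: kl_graph_def)
  have "wp (input_registers w) (decide_com k) (decide_time k (length vs))
      (\<lambda>R. R 0 \<noteq> 0 \<longleftrightarrow> well_covered G) (\<lambda>_. 0)"
  proof (cases "vs = []")
    case True
    then have "well_covered G" using assms(3) by (simp add: well_covered_empty)
    moreover have "input_registers w 0 = 0"
      using True by (simp add: w_def input_registers_def length_adjacency_word)
    ultimately show ?thesis using wp_decide_empty[of "input_registers w" k] True by simp
  next
    case False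
    then interpret graph_input G vs k
      using G assms(2-4) by (intro graph_input.intro) simp_all
    have iff: "all_good \<longleftrightarrow> well_covered G"
      by (rule all_good_iff_well_covered[OF P]) (simp only: assms(4) order_refl)
    show ?thesis using wp_decide unfolding iff inp_def w_def .
  qed
  then have "wp (input_registers w) (decide_com k) T
      (\<lambda>R. R 0 \<noteq> 0 \<longleftrightarrow> well_covered G) (\<lambda>_. 0)"
    using assms(5) by (rule wp_mono)
  then show ?thesis by (rule wp_halts) simp
qed

theorem corollary5:
  fixes l :: nat
  shows "promise_solvable_in_polynomial_time
           (graph_words {G. kl_graph 1 l G \<and> well_covered G})
           (graph_words {G. kl_graph 1 l G \<and> \<not> well_covered G})"
proof -
  \<comment> \<open>The tuple length demanded by \<open>well_covered_iff_greedy\<close>.\<close>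
  define k where "k = 2 * l + 1"
  let ?prog = "code 0 (decide_com k)"
  obtain p :: "nat poly" where p: "decide_time k n = poly p n" for n
    using polynomially_bounded_decide_time unfolding polynomially_bounded_def by blast
  have correct: "halted ?prog (run ?prog w (poly p (length w))) \<and>
      (snd (run ?prog w (poly p (length w))) 0 \<noteq> 0 \<longleftrightarrow> well_covered G)"
    if "kl_graph 1 l G" "w = adjacency_word G vs" "distinct vs" "set vs = pverts G"
    for G :: "nat pair_pre_digraph" and w vs
  proof -
    \<comment> \<open>The word has length \<open>n * n\<close>, which is at least the number
      \<open>n\<close> of vertices.\<close>
    have "decide_time k (length vs) \<le> poly p (length w)"
      unfolding p that(2) length_adjacency_word by (intro poly_nat_mono le_square)
    then show ?thesis using decide_correct[of l G vs k] that k_def by blast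
  qed
  show ?thesis
    unfolding promise_solvable_in_polynomial_time_def
  proof (intro exI conjI ballI)
    show "accepts_within ?prog w (poly p (length w))"
      if "w \<in> graph_words {G. kl_graph 1 l G \<and> well_covered G}" for w
      using that correct unfolding graph_words_def accepts_within_def by blast
    show "rejects_within ?prog w (poly p (length w))"
      if "w \<in> graph_words {G. kl_graph 1 l G \<and> \<not> well_covered G}" for w
      using that correct unfolding graph_words_def rejects_within_def by blast
  qed
qed

end
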